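(* Let $(\Omega,\mathcal{A})$ be a measurable space with a flow $\{\theta_t:t\in\mathbb{R}\}$, let $\mathbb{Q}$ be a $\sigma$-finite measure on $(\Omega,\mathcal{A})$ (not assumed stationary), and let $\xi$ be a diffuse and invariant random measure on $\mathbb{R}$ (the invariance property being assumed to hold $\mathbb{Q}$-a.e.). Assume that $\mathbb{Q}\{\xi(-\infty,0)<\infty\}=\mathbb{Q}\{\xi(0,\infty)<\infty\}=0$, and let $S_r$, $r\in\mathbb{R}$, be the generalised inverse of the diffuse random measure $\xi$, $$S_r:=\begin{cases}\sup\{t\ge0:\ \xi[0,t]=r\}, & r\ge0,\\ \sup\{t<0:\ \xi[t,0]=-r\}, & r<0.\end{cases}$$ Then $$\mathbb{Q}\{\theta_{S_r}\in\cdot\}=\mathbb{Q},\qquad r\in\mathbb{R},$$ if and only if $\xi$ is mass-stationary (with respect to $\mathbb{Q}$), and if and only if $\mathbb{Q}$ is the Palm measure of $\xi$ with respect to a $\sigma$-finite stationary measure $\mathbb{P}$ on $(\Omega,\mathcal{A})$. The measure $\mathbb{P}$ is uniquely determined by $\mathbb{Q}$ as follows: for each $w>0$ and each measurable function $f:\Omega\to[0,\infty)$, $$\mathbb{E}_{\mathbb{P}}f=w^{-1}\,\mathbb{E}_{\mathbb{Q}}\int_0^{S_w}f\circ\theta_s\,ds.$$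
   Context: Flow: measurable bijections $\theta_t:\Omega\to\Omega$, $t\in\mathbb{R}$, such that $(\omega,t)\mapsto\theta_t(\omega)$ is measurable, $\theta_0$ is the identity and $\theta_{s+t}=\theta_s\circ\theta_t$ for all $s,t\in\mathbb{R}$. For a random time $S$, $\theta_S$ denotes the map $\omega\mapsto\theta_{S(\omega)}\omega$. A measure $\mathbb{P}$ is stationary if $\mathbb{P}=\mathbb{P}\circ\theta_s$ for all $s\in\mathbb{R}$. $\mathbb{E}_{\mathbb{Q}}$, $\mathbb{E}_{\mathbb{P}}$ denote integration with respect to $\mathbb{Q}$, $\mathbb{P}$. A random measure $\xi$ on $\mathbb{R}$ is a kernel from $\Omega$ to $\mathbb{R}$ with $\xi(\omega,C)<\infty$ for all compact $C\subset\mathbb{R}$, for a.e. $\omega$ (with respect to the underlying measure). It is invariant if $\xi(\theta_t\omega,C-t)=\xi(\omega,C)$ for all Borel $C\subset\mathbb{R}$ and $t\in\mathbb{R}$, for a.e. $\omega$. Diffuse means atomless. Palm measure: for a $\sigma$-finite stationary $\mathbb{P}$ (under which $\xi$ is an invariant random measure), the Palm measure of $\xi$ with respect to $\mathbb{P}$ is $\mathbb{Q}_\xi(A):=\mathbb{E}_{\mathbb{P}}\int\mathbf{1}_{[0,1]}(s)\mathbf{1}_A(\theta_s)\,\xi(ds)$, $A\in\mathcal{A}$. Mass-stationarity: $\xi$ is mass-stationary (with respect to $\mathbb{Q}$) if for all bounded Borel sets $C\subset\mathbb{R}$ with $\lambda(C)>0$ and $\lambda(\partial C)=0$ ($\lambda$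 is Lebesgue measure) and all measurable $f:\Omega\times\mathbb{R}\to[0,\infty)$, $$\mathbb{E}_{\mathbb{Q}}\iint\mathbf{1}_C(u)\frac{\mathbf{1}_{C-u}(s)}{\xi(C-u)}f(\theta_s,s+u)\,\xi(ds)\,du=\mathbb{E}_{\mathbb{Q}}\int\mathbf{1}_C(u)f(\theta_0,u)\,du,$$ with the convention that any integration over a set of measure zero yields zero.
   Formalization: Uniqueness of P and the formula for E_P f are stated for P with P{ξ(ℝ)=0}=0: adding to P a stationary measure living on {ξ(ℝ)=0} leaves the Palm measure unchanged, so without this condition that part fails. Existence of such a P is proved. *)

theory Defs
  imports "HOL-Analysis.Analysis"
begin

text \<open>
  A measure \<open>M\<close> on \<open>(\<Omega>, \<A>)\<close> carries the measurable space
  as \<open>\<Omega> = space M\<close>, \<open>\<A> = sets M\<close>; a flow is a property of that measurable space only.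
\<close>

definition measurable_flow :: "'a measure \<Rightarrow> (real \<Rightarrow> 'a \<Rightarrow> 'a) \<Rightarrow> bool" where
  "measurable_flow M \<theta> \<longleftrightarrow>
     (\<lambda>(\<omega>, t). \<theta> t \<omega>) \<in> M \<Otimes>\<^sub>M borel \<rightarrow>\<^sub>M M \<and>
     (\<forall>t. \<theta> t \<in> M \<rightarrow>\<^sub>M M \<and> bij_betw (\<theta> t) (space M) (space M)) \<and>
     (\<forall>\<omega>\<in>space M. \<theta> 0 \<omega> = \<omega>) \<and>
     (\<forall>s t. \<forall>\<omega>\<in>space M. \<theta> (s + t) \<omega> = \<theta> s (\<theta> t \<omega>))"

text \<open>
  \<open>P \<circ> \<theta>\<^sub>s\<close> is the image of \<open>P\<close> under \<open>\<theta>\<^sub>-\<^sub>s\<close>,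
  so ranging over all \<open>s\<close> the inverse may be dropped.
\<close>

definition stationary :: "(real \<Rightarrow> 'a \<Rightarrow> 'a) \<Rightarrow> 'a measure \<Rightarrow> bool" where
  "stationary \<theta> P \<longleftrightarrow> (\<forall>s. distr P P (\<theta> s) = P)"

definition random_measure :: "'a measure \<Rightarrow> ('a \<Rightarrow> real measure) \<Rightarrow> bool" where
  "random_measure M \<xi> \<longleftrightarrow>
     (\<forall>\<omega>\<in>space M. sets (\<xi> \<omega>) = sets borel) \<and>
     (\<forall>C\<in>sets borel. (\<lambda>\<omega>. emeasure (\<xi> \<omega>) C) \<in> borel_measurable M) \<and>
     (AE \<omega> in M. \<forall>C. compact C \<longrightarrow> emeasure (\<xi> \<omega>) C < \<infinity>)"

definition diffuse :: "'a measure \<Rightarrow> ('a \<Rightarrow> real measure) \<Rightarrow> bool" where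
  "diffuse M \<xi> \<longleftrightarrow> (AE \<omega> in M. \<forall>x. emeasure (\<xi> \<omega>) {x} = 0)"

definition translate :: "real set \<Rightarrow> real \<Rightarrow> real set" where
  "translate C t = (\<lambda>x. x - t) ` C"

definition invariant_rm ::
    "(real \<Rightarrow> 'a \<Rightarrow> 'a) \<Rightarrow> 'a measure \<Rightarrow> ('a \<Rightarrow> real measure) \<Rightarrow> bool" where
  "invariant_rm \<theta> M \<xi> \<longleftrightarrow>
     (AE \<omega> in M. \<forall>t. \<forall>C\<in>sets borel.
        emeasure (\<xi> (\<theta> t \<omega>)) (translate C t) = emeasure (\<xi> \<omega>) C)"

text \<open>
  For a diffuse, locally finite measure with infinite mass on both half-lines the sets below are
  nonempty and bounded above, so the real supremum is the intended one.  For the remaining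
  \<open>\<omega>\<close> (a null set in the theorem) the value is arbitrary.
\<close>

definition gen_inverse :: "('a \<Rightarrow> real measure) \<Rightarrow> real \<Rightarrow> 'a \<Rightarrow> real" where
  "gen_inverse \<xi> r \<omega> =
     (if r \<ge> 0 then Sup {t. t \<ge> 0 \<and> emeasure (\<xi> \<omega>) {0..t} = ennreal r}
      else Sup {t. t < 0 \<and> emeasure (\<xi> \<omega>) {t..0} = ennreal (- r)})"

text \<open>
  If \<open>\<xi>(C - u) = 0\<close>, the inner integrand is supported on the null set
  \<open>C - u\<close>, so the inner integral is \<open>0\<close> although \<open>1 / 0 = \<infinity>\<close> in
  \<^typ>\<open>ennreal\<close>; this is the convention on integration over null sets.
\<close>

definition mass_stationary ::
    "(real \<Rightarrow> 'a \<Rightarrow> 'a) \<Rightarrow> 'a measure \<Rightarrow> ('a \<Rightarrow> real measure) \<Rightarrow> bool" where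
  "mass_stationary \<theta> Q \<xi> \<longleftrightarrow>
     (\<forall>C f. C \<in> sets borel \<longrightarrow> bounded C \<longrightarrow>
        emeasure lborel C > 0 \<longrightarrow> emeasure lborel (frontier C) = 0 \<longrightarrow>
        f \<in> borel_measurable (Q \<Otimes>\<^sub>M (borel :: real measure)) \<longrightarrow>
        (\<forall>x\<in>space (Q \<Otimes>\<^sub>M (borel :: real measure)). (0::real) \<le> f x) \<longrightarrow>
        (\<integral>\<^sup>+\<omega>. (\<integral>\<^sup>+u. (\<integral>\<^sup>+s.
             indicator C u * (indicator (translate C u) s / emeasure (\<xi> \<omega>) (translate C u))
               * ennreal (f (\<theta> s \<omega>, s + u)) \<partial>\<xi> \<omega>) \<partial>lborel) \<partial>Q)
        = (\<integral>\<^sup>+\<omega>. (\<integral>\<^sup>+u. indicator C u * ennreal (f (\<theta> 0 \<omega>, u)) \<partial>lborel) \<partial>Q))"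

definition is_palm_measure ::
    "(real \<Rightarrow> 'a \<Rightarrow> 'a) \<Rightarrow> 'a measure \<Rightarrow> ('a \<Rightarrow> real measure) \<Rightarrow> 'a measure \<Rightarrow> bool" where
  "is_palm_measure \<theta> P \<xi> Q \<longleftrightarrow>
     sets Q = sets P \<and>
     (\<forall>A\<in>sets P. emeasure Q A =
        (\<integral>\<^sup>+\<omega>. (\<integral>\<^sup>+s. indicator {0..1} s * indicator A (\<theta> s \<omega>) \<partial>\<xi> \<omega>) \<partial>P))"

definition palm_of_stationary ::
    "(real \<Rightarrow> 'a \<Rightarrow> 'a) \<Rightarrow> ('a \<Rightarrow> real measure) \<Rightarrow> 'a measure \<Rightarrow> 'a measure \<Rightarrow> bool" where
  "palm_of_stationary \<theta> \<xi> Q P \<longleftrightarrow>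
     sigma_finite_measure P \<and> stationary \<theta> P \<and>
     random_measure P \<xi> \<and> invariant_rm \<theta> P \<xi> \<and> is_palm_measure \<theta> P \<xi> Q"

text \<open>
  The Palm measure does not see the part of \<open>P\<close> living on \<open>{\<xi>(\<real>) = 0}\<close>: adding
  to \<open>P\<close> a stationary measure concentrated there leaves it unchanged.  Hence \<open>P\<close> is
  determined by its Palm measure only among the measures giving no mass to that set.
\<close>

definition no_mass_on_zero :: "('a \<Rightarrow> real measure) \<Rightarrow> 'a measure \<Rightarrow> bool" where
  "no_mass_on_zero \<xi> P \<longleftrightarrow> emeasure P {\<omega>\<in>space P. emeasure (\<xi> \<omega>) UNIV = 0} = 0"

text \<open>
  The law \<open>Q{\<theta>\<^sub>S \<in> \<cdot>}\<close> of the flow shifted by a random time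
  \<open>S\<close>.  Local finiteness and diffuseness of \<open>\<xi>\<close> hold almost everywhere only, so
  \<^const>\<open>gen_inverse\<close> is in general measurable only up to a null set; therefore the law is
  taken with respect to the completion of \<open>Q\<close>.
\<close>

definition shifted_law ::
    "(real \<Rightarrow> 'a \<Rightarrow> 'a) \<Rightarrow> 'a measure \<Rightarrow> ('a \<Rightarrow> real) \<Rightarrow> 'a measure" where
  "shifted_law \<theta> Q S = distr (completion Q) Q (\<lambda>\<omega>. \<theta> (S \<omega>) \<omega>)"

end

theory Submission
  imports Defs
begin

text \<open>
  Write \<open>T\<^sub>r = \<theta>\<^bsub>S\<^sub>r\<^esub>\<close>.  Since \<open>r \<mapsto> S\<^sub>r\<close> maps Lebesgue measure to
  \<open>\<xi>\<close> and \<open>T\<^sub>r T\<^sub>q = T\<^sub>r\<^sub>+\<^sub>q\<close>, integrals against \<open>\<xi>\<close> become Lebesgue integrals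
  over \<open>r\<close> along the orbit of \<open>T\<close>.  If \<open>Q\<close> is invariant under \<open>T\<close>, then, with
  \<open>\<eta> = \<theta>\<^sub>-\<^sub>u \<omega>\<close>, the integral
  of \<open>H(\<eta>,u,v)\<close> against \<open>Q(d\<omega>) du \<xi>(\<eta>,dv)\<close> is symmetric in
  \<open>u\<close> and \<open>v\<close> (the predicate \<open>exchange\<close>).  For
  \<open>H = 1\<^sub>C(u) 1\<^sub>C(v) f(\<theta>\<^sub>v \<eta>, v) / \<xi>(\<eta>,C)\<close> this is
  mass-stationarity; inserting a weight of unit \<open>\<xi>\<close>-mass it yields the stationary measure
  together with the refined Campbell formula.  The refined Campbell formula conversely gives the
  invariance under \<open>T\<close> and the expression of \<open>P\<close> through \<open>Q\<close>.
  Mass-stationarity on growing windows gives the invariance directly.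

  This argument needs a kernel which is diffuse and invariant everywhere.  In general the
  exceptional null set is not invariant under the flow, but each of the three conditions forces
  \<open>Q\<close> to live on a measurable flow-invariant set on which \<open>\<xi>\<close> is
  well-behaved, and off this set \<open>\<xi>\<close> may be replaced by Lebesgue measure.
\<close>

subsection \<open>Locally finite diffuse measures on the line\<close>

text \<open>\<open>T\<^sub>0\<close> need not be the identity: \<open>S\<^sub>0\<close> is the right
  end of the stretch starting at 0 that \<xi> does not charge. Invariance under
  \<open>T\<^sub>0\<close> alone forces \<open>S\<^sub>0 = 0\<close> for Q-almost every \<omega>.
  This one fact makes \<xi>(C - u) positive for u interior to C, so that the normalisation cancels;
  it makes \<open>T\<^sub>-\<^sub>r\<close> undo \<open>T\<^sub>r\<close>; and it lets the inner
  integral of the inversion formula start at 0. The symmetry in u and v expresses that a pair of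
  points may be viewed from either member: in mass coordinates the step r turns into -r. Q is not
  stationary, so an almost sure statement cannot be carried along orbits to Lebesgue-typical times.
  Each of the three conditions carries it to \<xi>-almost every time only, which is why the
  invariant set is cut out by the \<xi>-mass of visits. A stationary P may moreover charge paths
  without any mass; there the replacement by Lebesgue measure would alter the Palm measure, so P has
  to be restricted before the kernel is replaced.\<close>

definition mass_fn :: "real measure \<Rightarrow> real \<Rightarrow> real" where
  "mass_fn \<mu> t = (if t \<ge> 0 then measure \<mu> {0..t} else - measure \<mu> {t..0})"

text \<open>\<open>gen_inverse\<close> at the identity kernel, so that pathwise facts can be proved
  for one measure without a base space.\<close>

abbreviation mass_inv :: "real measure \<Rightarrow> real \<Rightarrow> real" where
  "mass_inv \<mu> r \<equiv> gen_inverse (\<lambda>\<mu>. \<mu>) r \<mu>"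

lemma gen_inverse_eq_mass_inv: "gen_inverse \<xi> r \<omega> = mass_inv (\<xi> \<omega>) r"
  by (simp add: gen_inverse_def)

locale line_measure =
  fixes \<mu> :: "real measure"
  assumes sets_eq [simp, measurable_cong]: "sets \<mu> = sets borel"
    and finite_Icc: "emeasure \<mu> {a..b} < \<infinity>"
    and atomless: "emeasure \<mu> {x} = 0"
    and left_inf: "emeasure \<mu> {..<0} = \<infinity>"
    and right_inf: "emeasure \<mu> {0<..} = \<infinity>"
begin

abbreviation "F \<equiv> mass_fn \<mu>"
abbreviation "S \<equiv> mass_inv \<mu>"

lemma space_eq [simp]: "space \<mu> = UNIV"
  using sets_eq_imp_space_eq[OF sets_eq] by simp

lemma emeasure_Icc: "emeasure \<mu> {a..b} = ennreal (measure \<mu> {a..b})"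
  using finite_Icc[of a b] by (simp add: emeasure_eq_ennreal_measure)

lemma emeasure_Ico:
  assumes "a \<le> b" shows "emeasure \<mu> {a..<b} = emeasure \<mu> {a..b}"
proof -
  have "{a..b} = {a..<b} \<union> {b}" using assms by auto
  also have "emeasure \<mu> \<dots> = emeasure \<mu> {a..<b} + emeasure \<mu> {b}"
    by (intro plus_emeasure[symmetric]) auto
  finally show ?thesis by (simp add: atomless)
qed

lemma measure_split:
  assumes "a \<le> b" "b \<le> c"
  shows "measure \<mu> {a..c} = measure \<mu> {a..b} + measure \<mu> {b..c}"
proof -
  have "{a..c} = {a..<b} \<union> {b..c}" using assms by auto
  also have "emeasure \<mu> \<dots> = emeasure \<mu> {a..<b} + emeasure \<mu> {b..c}"
    by (intro plus_emeasure[symmetric]) auto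
  finally have "ennreal (measure \<mu> {a..c}) = ennreal (measure \<mu> {a..b} + measure \<mu> {b..c})"
    using assms by (simp add: emeasure_Ico emeasure_Icc)
  then show ?thesis by (subst (asm) ennreal_inj) auto
qed

lemma measure_point: "measure \<mu> {x..x} = 0"
  by (simp add: measure_def atomless)

lemma F_0 [simp]: "F 0 = 0"
  using measure_point[of 0] by (simp add: mass_fn_def)

lemma F_diff:
  assumes "a \<le> b" shows "F b - F a = measure \<mu> {a..b}"
proof -
  consider "0 \<le> a" | "a < 0" "0 \<le> b" | "b < 0" by linarith
  then show ?thesis
  proof cases
    case 1 then show ?thesis using assms measure_split[of 0 a b] by (simp add: mass_fn_def)
  next
    case 2 then show ?thesis using assms measure_split[of a 0 b] by (simp add: mass_fn_def)
  next
    case 3 then show ?thesis using assms measure_split[of a b 0] by (simp add: mass_fn_def)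
  qed
qed

lemma emeasure_Ico_F: "a \<le> b \<Longrightarrow> emeasure \<mu> {a..<b} = ennreal (F b - F a)"
  by (simp add: emeasure_Ico emeasure_Icc F_diff)

lemma F_mono: "a \<le> b \<Longrightarrow> F a \<le> F b"
  using F_diff[of a b] measure_nonneg[of \<mu> "{a..b}"] by linarith

text \<open>Oscillation of \<open>F\<close> near x is bounded by the mass of shrinking closed
  intervals, which tends to the mass of \<open>{x}\<close> by continuity from above; local
  finiteness and the absence of atoms enter here.\<close>

lemma F_isCont: "isCont F x"
proof -
  have "(\<lambda>n. emeasure \<mu> {x - 1 / Suc n..x + 1 / Suc n}) \<longlonglongrightarrow>
      emeasure \<mu> (\<Inter>n. {x - 1 / Suc n..x + 1 / Suc n})"
    using finite_Icc
    by (intro Lim_emeasure_decseq) (auto simp: decseq_def less_top[symmetric] frac_le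
        intro!: order_trans[OF diff_left_mono] order_trans[OF _ add_left_mono])
  also have "(\<Inter>n. {x - 1 / Suc n..x + 1 / Suc n}) = {x}"
  proof -
    have "y = x" if "\<And>n. x - 1 / real (Suc n) \<le> y \<and> y \<le> x + 1 / real (Suc n)" for y
    proof (rule ccontr)
      assume "y \<noteq> x"
      then have "\<bar>y - x\<bar> > 0" by simp
      then obtain n where "1 / real (Suc n) < \<bar>y - x\<bar>" by (meson nat_approx_posE)
      with that[of n] show False by linarith
    qed
    then show ?thesis by auto
  qed
  finally have lim: "(\<lambda>n. emeasure \<mu> {x - 1 / Suc n..x + 1 / Suc n}) \<longlonglongrightarrow> 0"
    by (simp add: atomless)
  show ?thesis
    unfolding continuous_at_eps_delta
  proof (intro allI impI)
    fix e :: real assume "e > 0"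
    then have "eventually (\<lambda>n. emeasure \<mu> {x - 1 / Suc n..x + 1 / Suc n} < ennreal e) sequentially"
      using order_tendstoD(2)[OF lim, of "ennreal e"] by simp
    then obtain n where "emeasure \<mu> {x - 1 / Suc n..x + 1 / Suc n} < ennreal e"
      by (auto simp: eventually_sequentially)
    then have n: "F (x + 1 / Suc n) - F (x - 1 / Suc n) < e"
      by (subst F_diff) (auto simp: emeasure_Icc ennreal_less_iff intro: order_trans[of _ x])
    show "\<exists>d>0. \<forall>x'. dist x' x < d \<longrightarrow> dist (F x') (F x) < e"
    proof (intro exI conjI allI impI)
      show "0 < 1 / real (Suc n)" by simp
      fix y assume "dist y x < 1 / real (Suc n)"
      then have y: "x - 1 / Suc n \<le> y" "y \<le> x + 1 / Suc n"
        by (auto simp: dist_real_def abs_if split: if_splits)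
      have "x - 1 / Suc n \<le> x" "x \<le> x + 1 / Suc n" by auto
      then have "F (x - 1 / Suc n) \<le> F x" "F x \<le> F (x + 1 / Suc n)" by (auto intro: F_mono)
      then show "dist (F y) (F x) < e"
        using F_mono[OF y(1)] F_mono[OF y(2)] n by (auto simp: dist_real_def)
    qed
  qed
qed

lemma F_unbounded_above: "\<exists>t\<ge>0. r < F t"
proof (rule ccontr)
  assume "\<not> ?thesis"
  then have le: "F t \<le> r" if "t \<ge> 0" for t using that by force
  have "emeasure \<mu> {0<..} \<le> emeasure \<mu> (\<Union>n. {0..real n})"
    by (intro emeasure_mono) (auto simp: real_arch_simple)
  also have "\<dots> = (SUP n. emeasure \<mu> {0..real n})"
    by (intro SUP_emeasure_incseq[symmetric]) (auto simp: incseq_def)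
  also have "\<dots> \<le> ennreal r"
    using le by (intro SUP_least) (simp add: emeasure_Icc F_diff[symmetric] ennreal_leI)
  finally show False by (simp add: right_inf top_unique)
qed

lemma F_unbounded_below: "\<exists>t\<le>0. F t < r"
proof (rule ccontr)
  assume "\<not> ?thesis"
  then have le: "r \<le> F t" if "t \<le> 0" for t using that by force
  have "\<exists>n. - real n \<le> x" for x
    using real_arch_simple[of "-x"] by (auto intro: exI[of _ "nat _"] simp: minus_le_iff)
  then have "emeasure \<mu> {..<0} \<le> emeasure \<mu> (\<Union>n. {-real n..0})"
    by (intro emeasure_mono) auto
  also have "\<dots> = (SUP n. emeasure \<mu> {-real n..0})"
    by (intro SUP_emeasure_incseq[symmetric]) (auto simp: incseq_def)
  also have "\<dots> \<le> ennreal (-r)"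
    using le by (intro SUP_least) (simp add: emeasure_Icc F_diff[symmetric] ennreal_leI)
  finally show False by (simp add: left_inf top_unique)
qed

text \<open>For negative r the equation \<open>F t = r\<close> already forces t to be negative, so a
  single level set describes both branches of the definition.\<close>

lemma S_eq_Sup: "S r = Sup {t. F t = r \<and> (0 \<le> r \<longrightarrow> 0 \<le> t)}"
proof (cases "r \<ge> 0")
  case True
  then have "{t. t \<ge> 0 \<and> emeasure \<mu> {0..t} = ennreal r} = {t. F t = r \<and> (0 \<le> r \<longrightarrow> 0 \<le> t)}"
    by (auto simp: emeasure_Icc mass_fn_def)
  then show ?thesis using True by (simp add: gen_inverse_def)
next
  case False
  then have "{t. t < 0 \<and> emeasure \<mu> {t..0} = ennreal (-r)} = {t. F t = r \<and> (0 \<le> r \<longrightarrow> 0 \<le> t)}"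
    using measure_nonneg[of \<mu>]
    by (auto simp: emeasure_Icc mass_fn_def split: if_splits)
  then show ?thesis using False by (simp add: gen_inverse_def)
qed

text \<open>The level set is nonempty by the intermediate value theorem, bounded because
  \<open>F\<close> exceeds every level, and closed by continuity; hence its supremum is
  attained.\<close>

lemma S_mem: "F (S r) = r \<and> (0 \<le> r \<longrightarrow> 0 \<le> S r)"
  and S_upper: "F t = r \<Longrightarrow> (0 \<le> r \<Longrightarrow> 0 \<le> t) \<Longrightarrow> t \<le> S r"
proof -
  let ?Y = "{t. F t = r \<and> (0 \<le> r \<longrightarrow> 0 \<le> t)}"
  obtain b where b: "0 \<le> b" "r < F b" using F_unbounded_above by blast
  obtain a where a: "a \<le> 0" "F a < r" using F_unbounded_below by blast
  have bdd: "bdd_above ?Y"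
    using b F_mono by (intro bdd_aboveI[of _ b]) (smt (verit) mem_Collect_eq)
  have ne: "?Y \<noteq> {}"
  proof (cases "0 \<le> r")
    case True
    then have "\<exists>x\<ge>0. x \<le> b \<and> F x = r"
      using b F_isCont by (intro IVT) auto
    then show ?thesis by auto
  next
    case False
    then have "\<exists>x\<ge>a. x \<le> b \<and> F x = r"
      using a b F_isCont by (intro IVT) auto
    then show ?thesis using False by auto
  qed
  have c: "continuous_on UNIV F" by (simp add: F_isCont continuous_at_imp_continuous_on)
  have "closed {t. F t = r}" by (intro closed_Collect_eq c continuous_on_const)
  moreover have "?Y = {t. F t = r} \<inter> (if 0 \<le> r then {0..} else UNIV)" by auto
  ultimately have "closed ?Y" by (auto intro: closed_Int)
  from closed_contains_Sup[OF ne bdd this]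
  show "F (S r) = r \<and> (0 \<le> r \<longrightarrow> 0 \<le> S r)" by (simp add: S_eq_Sup)
  show "F t = r \<Longrightarrow> (0 \<le> r \<Longrightarrow> 0 \<le> t) \<Longrightarrow> t \<le> S r"
    unfolding S_eq_Sup using bdd by (intro cSup_upper) auto
qed

lemma F_S [simp]: "F (S r) = r"
  using S_mem by blast

text \<open>\<open>S r\<close> is the right end of the level set of r, which makes \<open>S\<close>
  the right-continuous inverse and the strict inequalities the correct ones. Measurability, the
  image of Lebesgue measure and the behaviour under shifts all follow from this equivalence.\<close>

lemma S_less_iff: "S r < t \<longleftrightarrow> r < F t"
proof
  assume "r < F t"
  then show "S r < t" using F_mono[of t "S r"] by (force simp: not_le[symmetric])
next
  assume less: "S r < t"
  then have "r \<le> F t" using F_mono[of "S r" t] by simp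
  moreover have "F t \<noteq> r" using S_upper[of t r] S_mem[of r] less by auto
  ultimately show "r < F t" by simp
qed

lemma S_measurable [measurable]: "S \<in> borel_measurable borel"
  by (rule borel_measurable_iff_less[THEN iffD2]) (simp add: S_less_iff lessThan_def[symmetric])

lemma le_S_iff: "t \<le> S r \<longleftrightarrow> F t \<le> r"
  using S_less_iff[of r t] by linarith

text \<open>The preimage of \<open>{a..<b}\<close> under \<open>S\<close> is exactly
  \<open>{F a..<F b}\<close>. Half-open intervals of this orientation are chosen as generator
  because they need no correction at the endpoints.\<close>

lemma distr_S: "distr lborel borel S = \<mu>"
proof (rule measure_eqI_generator_eq[symmetric])
  let ?E = "range (\<lambda>(a, b). {a..<b::real})"
  show "Int_stable ?E"
  proof (rule Int_stableI)
    fix A B assume "A \<in> ?E" "B \<in> ?E"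
    then obtain a b c d where "A = {a..<b}" "B = {c..<d}" by auto
    then have "A \<inter> B = {max a c..<min b d}" by auto
    then show "A \<inter> B \<in> ?E" by auto
  qed
  show "?E \<subseteq> Pow UNIV" by auto
  show "sets \<mu> = sigma_sets UNIV ?E"
    by (simp add: borel_eq_atLeastLessThan)
  show "sets (distr lborel borel S) = sigma_sets UNIV ?E"
    by (simp add: borel_eq_atLeastLessThan)
  show "range (\<lambda>i::nat. {- real i..<real i}) \<subseteq> ?E" by auto
  show "(\<Union>i::nat. {- real i..<real i}) = UNIV"
  proof -
    have "\<exists>i::nat. - real i \<le> x \<and> x < real i" for x
      using reals_Archimedean2[of "\<bar>x\<bar>"] by (metis abs_less_iff less_imp_le minus_less_iff)
    then show ?thesis by auto
  qed
  show "emeasure \<mu> {- real i..<real i} \<noteq> \<infinity>" for i :: nat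
    by (simp add: emeasure_Ico emeasure_Icc)
  fix X assume "X \<in> ?E"
  then obtain a b where X: "X = {a..<b}" by auto
  show "emeasure \<mu> X = emeasure (distr lborel borel S) X"
  proof (cases "a \<le> b")
    case True
    have "S -` X = {F a..<F b}" by (auto simp: X le_S_iff S_less_iff)
    then show ?thesis
      using True F_mono[OF True] by (simp add: emeasure_distr emeasure_Ico_F X)
  qed (simp add: X)
qed

lemma nn_integral_mass:
  assumes "g \<in> borel_measurable borel"
  shows "(\<integral>\<^sup>+s. g s \<partial>\<mu>) = (\<integral>\<^sup>+r. g (S r) \<partial>lborel)"
  using assms by (subst distr_S[symmetric]) (simp add: nn_integral_distr)

lemma emeasure_UNIV: "emeasure \<mu> UNIV = \<infinity>"
  using emeasure_mono[of "{0<..}" UNIV \<mu>] by (simp add: right_inf top_unique)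

end

subsection \<open>Kernels and flows\<close>

lemma nn_integral_lborel_shift:
  fixes g :: "real \<Rightarrow> ennreal"
  assumes "g \<in> borel_measurable borel"
  shows "(\<integral>\<^sup>+x. g (x + c) \<partial>lborel) = (\<integral>\<^sup>+x. g x \<partial>lborel)"
  using nn_integral_real_affine[OF assms, of 1 c] by (simp add: add.commute)

lemma nn_integral_lborel_minus:
  fixes g :: "real \<Rightarrow> ennreal"
  assumes "g \<in> borel_measurable borel"
  shows "(\<integral>\<^sup>+x. g (- x) \<partial>lborel) = (\<integral>\<^sup>+x. g x \<partial>lborel)"
  using nn_integral_real_affine[OF assms, of "-1" 0] by simp

lemma indicator_translate: "indicator (translate B t) s = indicator B (s + t)"
  by (auto simp: translate_def indicator_def image_iff algebra_simps intro: bexI[of _ "s + t"])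

lemma translate_eq_vimage: "translate B t = (\<lambda>s. s + t) -` B"
  by (force simp: translate_def image_iff)

lemma translate_in_borel [measurable]: "B \<in> sets borel \<Longrightarrow> translate B t \<in> sets borel"
  unfolding translate_eq_vimage using measurable_sets[of "\<lambda>s. s + t" borel borel B] by simp

lemma translate_translate: "translate (translate B s) t = translate B (s + t)"
  by (auto simp: translate_eq_vimage add_ac)

lemma translate_0 [simp]: "translate B 0 = B"
  by (simp add: translate_def)

locale line_kernel =
  fixes M :: "'a measure" and \<xi> :: "'a \<Rightarrow> real measure"
  assumes line: "\<omega> \<in> space M \<Longrightarrow> line_measure (\<xi> \<omega>)"
    and kernel: "B \<in> sets borel \<Longrightarrow> (\<lambda>\<omega>. emeasure (\<xi> \<omega>) B) \<in> borel_measurable M"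
begin

abbreviation F :: "'a \<Rightarrow> real \<Rightarrow> real" where "F \<omega> \<equiv> mass_fn (\<xi> \<omega>)"
abbreviation S :: "'a \<Rightarrow> real \<Rightarrow> real" where "S \<omega> \<equiv> mass_inv (\<xi> \<omega>)"

lemma F_measurable_fixed: "(\<lambda>\<omega>. F \<omega> t) \<in> borel_measurable M"
  using kernel[of "{0..t}"] kernel[of "{t..0}"] unfolding mass_fn_def measure_def by simp

text \<open>Comparing \<open>S\<close> with a constant a only involves \<open>F\<close> at the fixed
  time a, where measurability is that of the kernel; this yields joint measurability in path and
  level.\<close>

lemma S_measurable [measurable (raw)]:
  assumes f: "f \<in> measurable N M" and r: "r \<in> borel_measurable N"
  shows "(\<lambda>x. S (f x) (r x)) \<in> borel_measurable N"
proof (rule borel_measurable_iff_less[THEN iffD2], rule allI)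
  fix a
  note [measurable] = f r measurable_compose[OF f F_measurable_fixed]
  have "{x \<in> space N. S (f x) (r x) < a} = {x \<in> space N. r x < F (f x) a}"
    using measurable_space[OF f] by (auto simp: line_measure.S_less_iff[OF line])
  then show "{x \<in> space N. S (f x) (r x) < a} \<in> sets N" by simp
qed

text \<open>The same equivalence read backwards: comparing \<open>F\<close> with a constant involves
  \<open>S\<close> at a fixed level, so joint measurability in time costs no approximation
  argument.\<close>

lemma F_measurable [measurable (raw)]:
  assumes f: "f \<in> measurable N M" and t: "t \<in> borel_measurable N"
  shows "(\<lambda>x. F (f x) (t x)) \<in> borel_measurable N"
proof (rule borel_measurable_iff_greater[THEN iffD2], rule allI)
  fix a
  note [measurable] = f t
  have "{x \<in> space N. a < F (f x) (t x)} = {x \<in> space N. S (f x) a < t x}"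
    using measurable_space[OF f] by (auto simp: line_measure.S_less_iff[OF line])
  then show "{x \<in> space N. a < F (f x) (t x)} \<in> sets N" by simp
qed

lemma nn_integral_kernel:
  assumes "\<omega> \<in> space M" "g \<in> borel_measurable borel"
  shows "(\<integral>\<^sup>+s. g s \<partial>\<xi> \<omega>) = (\<integral>\<^sup>+r. g (S \<omega> r) \<partial>lborel)"
  using line_measure.nn_integral_mass[OF line] assms by blast

text \<open>Mass coordinates turn the varying measure \<open>\<xi> (f x)\<close> into the fixed
  Lebesgue measure, for which measurability of parametrised integrals is available.\<close>

lemma nn_integral_kernel_measurable [measurable (raw)]:
  assumes g: "case_prod g \<in> borel_measurable (N \<Otimes>\<^sub>M borel)" and f: "f \<in> measurable N M"
  shows "(\<lambda>x. \<integral>\<^sup>+s. g x s \<partial>\<xi> (f x)) \<in> borel_measurable N"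
proof -
  note [measurable] = f
  have "(\<lambda>x. \<integral>\<^sup>+s. g x s \<partial>\<xi> (f x)) \<in> borel_measurable N \<longleftrightarrow>
      (\<lambda>x. \<integral>\<^sup>+r. g x (S (f x) r) \<partial>lborel) \<in> borel_measurable N"
  proof (rule measurable_cong)
    fix x assume x: "x \<in> space N"
    then have "g x \<in> borel_measurable borel"
      using measurable_compose[OF measurable_Pair1' g] by simp
    then show "(\<integral>\<^sup>+s. g x s \<partial>\<xi> (f x)) = (\<integral>\<^sup>+r. g x (S (f x) r) \<partial>lborel)"
      using measurable_space[OF f x] by (intro nn_integral_kernel)
  qed
  moreover have "(\<lambda>x. \<integral>\<^sup>+r. g x (S (f x) r) \<partial>lborel) \<in> borel_measurable N"
  proof (rule lborel.borel_measurable_nn_integral)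
    have "(\<lambda>p. case_prod g (fst p, S (f (fst p)) (snd p))) \<in> borel_measurable (N \<Otimes>\<^sub>M lborel)"
      by (rule measurable_compose[OF _ g]) measurable
    then show "(\<lambda>(x, r). g x (S (f x) r)) \<in> borel_measurable (N \<Otimes>\<^sub>M lborel)"
      by (simp add: case_prod_beta')
  qed
  ultimately show ?thesis by simp
qed

lemma emeasure_kernel_measurable [measurable (raw)]:
  assumes "B \<in> sets borel" "f \<in> measurable N M"
  shows "(\<lambda>x. emeasure (\<xi> (f x)) B) \<in> borel_measurable N"
  using measurable_compose[OF assms(2) kernel[OF assms(1)]] .

end

locale flow_on =
  fixes M :: "'a measure" and \<theta> :: "real \<Rightarrow> 'a \<Rightarrow> 'a"
  assumes flow: "measurable_flow M \<theta>"
begin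

lemma flow_measurable [measurable (raw)]:
  assumes "t \<in> borel_measurable N" "f \<in> measurable N M"
  shows "(\<lambda>x. \<theta> (t x) (f x)) \<in> measurable N M"
proof -
  have "(\<lambda>(\<omega>, t). \<theta> t \<omega>) \<in> M \<Otimes>\<^sub>M borel \<rightarrow>\<^sub>M M"
    using flow by (simp add: measurable_flow_def)
  from measurable_compose[OF measurable_Pair[OF assms(2,1)] this] show ?thesis by simp
qed

lemma flow_space [simp]: "\<omega> \<in> space M \<Longrightarrow> \<theta> t \<omega> \<in> space M"
  using flow by (auto simp: measurable_flow_def bij_betw_def)

lemma flow_0 [simp]: "\<omega> \<in> space M \<Longrightarrow> \<theta> 0 \<omega> = \<omega>"
  using flow by (simp add: measurable_flow_def)

lemma flow_add [simp]: "\<omega> \<in> space M \<Longrightarrow> \<theta> s (\<theta> t \<omega>) = \<theta> (s + t) \<omega>"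
  using flow by (simp add: measurable_flow_def)

end

locale flow_kernel = line_kernel M \<xi> + flow_on M \<theta>
  for M :: "'a measure" and \<xi> and \<theta> :: "real \<Rightarrow> 'a \<Rightarrow> 'a" +
  assumes invariant: "\<omega> \<in> space M \<Longrightarrow> B \<in> sets borel \<Longrightarrow>
      emeasure (\<xi> (\<theta> t \<omega>)) (translate B t) = emeasure (\<xi> \<omega>) B"
begin

lemma kernel_shift:
  assumes "\<omega> \<in> space M"
  shows "\<xi> (\<theta> t \<omega>) = distr (\<xi> \<omega>) borel (\<lambda>s. s - t)"
proof (rule measure_eqI)
  interpret l: line_measure "\<xi> \<omega>" using line assms .
  interpret l': line_measure "\<xi> (\<theta> t \<omega>)" using line assms by simp
  show "sets (\<xi> (\<theta> t \<omega>)) = sets (distr (\<xi> \<omega>) borel (\<lambda>s. s - t))" by simp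
  fix B assume "B \<in> sets (\<xi> (\<theta> t \<omega>))"
  then have B: "B \<in> sets borel" by simp
  have "emeasure (\<xi> (\<theta> t \<omega>)) (translate (translate B (-t)) t) = emeasure (\<xi> \<omega>) (translate B (-t))"
    using assms B by (intro invariant) auto
  then show "emeasure (\<xi> (\<theta> t \<omega>)) B = emeasure (distr (\<xi> \<omega>) borel (\<lambda>s. s - t)) B"
    using B by (simp add: translate_translate emeasure_distr) (simp add: translate_eq_vimage)
qed

lemma nn_integral_kernel_shift:
  assumes "\<omega> \<in> space M" "g \<in> borel_measurable borel"
  shows "(\<integral>\<^sup>+s. g s \<partial>\<xi> (\<theta> t \<omega>)) = (\<integral>\<^sup>+s. g (s - t) \<partial>\<xi> \<omega>)"
proof -
  interpret l: line_measure "\<xi> \<omega>" using line assms(1) .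
  show ?thesis using assms by (simp add: kernel_shift nn_integral_distr)
qed

lemma F_shift:
  assumes "\<omega> \<in> space M"
  shows "F (\<theta> t \<omega>) s = F \<omega> (s + t) - F \<omega> t"
proof -
  interpret l: line_measure "\<xi> \<omega>" using line assms .
  have *: "measure (\<xi> (\<theta> t \<omega>)) {a..b} = measure (\<xi> \<omega>) {a + t..b + t}" for a b
  proof -
    have "(\<lambda>s. s - t) -` {a..b} = {a + t..b + t}" by auto
    then show ?thesis using assms by (simp add: kernel_shift measure_distr)
  qed
  show ?thesis
    using l.F_diff[of t "s + t"] l.F_diff[of "s + t" t]
    by (cases "0 \<le> s") (simp_all add: mass_fn_def[of "\<xi> (\<theta> t \<omega>)"] *)
qed

text \<open>Moving the origin to t lowers positions by t and levels by \<open>F \<omega> t\<close>;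
  two reals with the same strict upper bounds coincide.\<close>

lemma S_shift:
  assumes "\<omega> \<in> space M"
  shows "S (\<theta> t \<omega>) r = S \<omega> (r + F \<omega> t) - t"
proof -
  interpret l: line_measure "\<xi> \<omega>" using line assms .
  interpret l': line_measure "\<xi> (\<theta> t \<omega>)" using line assms by simp
  have "S (\<theta> t \<omega>) r < a \<longleftrightarrow> S \<omega> (r + F \<omega> t) - t < a" for a
    using l.S_less_iff[of "r + F \<omega> t" "a + t"]
    by (simp add: l'.S_less_iff F_shift assms less_diff_eq diff_less_eq)
  then show ?thesis by (meson less_irrefl linorder_neqE)
qed

abbreviation T :: "real \<Rightarrow> 'a \<Rightarrow> 'a" where "T r \<omega> \<equiv> \<theta> (S \<omega> r) \<omega>"

text \<open>The cocycle identity behind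
  \<open>T\<^sub>r T\<^sub>q = T\<^sub>r\<^sub>+\<^sub>q\<close>: the level reached at
  \<open>S \<omega> q\<close> is exactly q.\<close>

lemma S_T: "\<omega> \<in> space M \<Longrightarrow> S (T q \<omega>) r = S \<omega> (r + q) - S \<omega> q"
  using line_measure.F_S[OF line] by (simp add: S_shift)

end

subsection \<open>Mass-stationarity and invariance under mass shifts\<close>

lemma measurable_compose_uncurry3:
  assumes "(\<lambda>(x, y, z). h x y z) \<in> measurable (A \<Otimes>\<^sub>M B \<Otimes>\<^sub>M C) D"
    and "f \<in> measurable N A" "g \<in> measurable N B" "k \<in> measurable N C"
  shows "(\<lambda>x. h (f x) (g x) (k x)) \<in> measurable N D"
  using measurable_compose[OF measurable_Pair[OF assms(2) measurable_Pair[OF assms(3,4)]] assms(1)]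
  by simp

lemma measurable_compose_uncurry:
  assumes "(\<lambda>(x, y). h x y) \<in> measurable (A \<Otimes>\<^sub>M B) D"
    and "f \<in> measurable N A" "g \<in> measurable N B"
  shows "(\<lambda>x. h (f x) (g x)) \<in> measurable N D"
  using measurable_compose[OF measurable_Pair[OF assms(2,3)] assms(1)] by simp

locale measured_flow_kernel = flow_kernel Q \<xi> \<theta> + sigma_finite_measure Q
  for Q :: "'a measure" and \<xi> :: "'a \<Rightarrow> real measure" and \<theta> :: "real \<Rightarrow> 'a \<Rightarrow> 'a"
begin

section \<open>Invariance under mass shifts and the exchange formula\<close>

sublocale QL: pair_sigma_finite Q lborel ..

definition mass_shift_invariant :: bool where
  "mass_shift_invariant \<longleftrightarrow> (\<forall>r. distr Q Q (T r) = Q)"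

text \<open>A mass-transport principle. In the frame \<eta> the origin of \<omega> sits at u, so u
  and v are positions in one coordinate system and can be interchanged for arbitrary H.\<close>

definition exchange :: bool where
  "exchange \<longleftrightarrow> (\<forall>H. (\<lambda>(\<eta>, u, v). H \<eta> u v) \<in> borel_measurable (Q \<Otimes>\<^sub>M borel \<Otimes>\<^sub>M borel) \<longrightarrow>
    (\<integral>\<^sup>+\<omega>. \<integral>\<^sup>+u. \<integral>\<^sup>+v. H (\<theta> (- u) \<omega>) u v \<partial>\<xi> (\<theta> (- u) \<omega>) \<partial>lborel \<partial>Q) =
    (\<integral>\<^sup>+\<omega>. \<integral>\<^sup>+u. \<integral>\<^sup>+v. H (\<theta> (- u) \<omega>) v u \<partial>\<xi> (\<theta> (- u) \<omega>) \<partial>lborel \<partial>Q :: ennreal))"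

lemma nn_integral_T:
  assumes "mass_shift_invariant" "g \<in> borel_measurable Q"
  shows "(\<integral>\<^sup>+\<omega>. g (T r \<omega>) \<partial>Q) = (\<integral>\<^sup>+\<omega>. g \<omega> \<partial>Q)"
proof -
  have "(\<integral>\<^sup>+\<omega>. g \<omega> \<partial>distr Q Q (T r)) = (\<integral>\<^sup>+\<omega>. g (T r \<omega>) \<partial>Q)"
    using assms(2) by (intro nn_integral_distr) measurable
  with assms(1) show ?thesis by (simp add: mass_shift_invariant_def)
qed

text \<open>After the shift \<open>T 0\<close> the quantity becomes
  \<open>S \<omega> 0 - S \<omega> 0\<close> by the cocycle identity. The property thus holds for
  the image law, which is Q.\<close>

lemma AE_S_0:
  assumes "mass_shift_invariant"
  shows "AE \<omega> in Q. S \<omega> 0 = 0"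
proof -
  have "AE \<omega> in distr Q Q (T 0). S \<omega> 0 = 0"
    by (subst AE_distr_iff) (auto simp: S_T intro!: AE_I2)
  moreover have "distr Q Q (T 0) = Q" using assms unfolding mass_shift_invariant_def by blast
  ultimately show ?thesis by (simp only:)
qed

text \<open>For a fixed mass step r both sides are integrals of \<open>G\<close>, one of them
  evaluated at \<open>T r \<omega>\<close> with step -r. Invariance removes \<open>T r\<close>, and
  the reflection r to -r preserves Lebesgue measure.\<close>

lemma exchange_if_mass_shift_invariant:
  assumes A: "mass_shift_invariant"
  shows "exchange"
  unfolding exchange_def
proof (intro allI impI)
  fix H :: "'a \<Rightarrow> real \<Rightarrow> real \<Rightarrow> ennreal"
  assume H: "(\<lambda>(\<eta>, u, v). H \<eta> u v) \<in> borel_measurable (Q \<Otimes>\<^sub>M borel \<Otimes>\<^sub>M borel)"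
  have [measurable (raw)]: "(\<lambda>x. H (f x) (a x) (b x)) \<in> borel_measurable N"
    if "f \<in> measurable N Q" "a \<in> borel_measurable N" "b \<in> borel_measurable N"
    for f a b and N :: "'c measure"
    by (rule measurable_compose_uncurry3[OF H that])
  define G where "G r \<omega> = (\<integral>\<^sup>+u. H (\<theta> (- u) \<omega>) (S \<omega> r + u) u \<partial>lborel)" for r \<omega>
  have [measurable]: "(\<lambda>(\<omega>, r). G r \<omega>) \<in> borel_measurable (Q \<Otimes>\<^sub>M borel)"
    unfolding G_def by measurable
  have [measurable]: "G r \<in> borel_measurable Q" for r
    unfolding G_def by measurable
  have kernel_eq: "(\<integral>\<^sup>+v. g v \<partial>\<xi> (\<theta> (- u) \<omega>)) = (\<integral>\<^sup>+r. g (S \<omega> r + u) \<partial>lborel)"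
    if "\<omega> \<in> space Q" "g \<in> borel_measurable borel" for g u \<omega>
  proof -
    have "(\<integral>\<^sup>+v. g v \<partial>\<xi> (\<theta> (- u) \<omega>)) = (\<integral>\<^sup>+s. g (s - - u) \<partial>\<xi> \<omega>)"
      by (rule nn_integral_kernel_shift[OF that])
    also have "\<dots> = (\<integral>\<^sup>+r. g (S \<omega> r - - u) \<partial>lborel)"
      using that by (intro nn_integral_kernel) auto
    finally show ?thesis by simp
  qed
  have "(\<integral>\<^sup>+\<omega>. \<integral>\<^sup>+u. \<integral>\<^sup>+v. H (\<theta> (- u) \<omega>) u v \<partial>\<xi> (\<theta> (- u) \<omega>) \<partial>lborel \<partial>Q) =
      (\<integral>\<^sup>+\<omega>. \<integral>\<^sup>+u. \<integral>\<^sup>+r. H (\<theta> (- u) \<omega>) u (S \<omega> r + u) \<partial>lborel \<partial>lborel \<partial>Q)"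
    by (intro nn_integral_cong kernel_eq) auto
  also have "\<dots> = (\<integral>\<^sup>+\<omega>. \<integral>\<^sup>+r. \<integral>\<^sup>+u. H (\<theta> (- u) \<omega>) u (S \<omega> r + u) \<partial>lborel \<partial>lborel \<partial>Q)"
    by (rule nn_integral_cong, rule lborel_pair.Fubini') measurable
  also have "\<dots> = (\<integral>\<^sup>+r. \<integral>\<^sup>+\<omega>. \<integral>\<^sup>+u. H (\<theta> (- u) \<omega>) u (S \<omega> r + u) \<partial>lborel \<partial>Q \<partial>lborel)"
    by (intro QL.Fubini'[symmetric]) measurable
  also have "\<dots> = (\<integral>\<^sup>+r. \<integral>\<^sup>+\<omega>. G (- r) (T r \<omega>) \<partial>Q \<partial>lborel)"
  proof (rule nn_integral_cong, rule nn_integral_cong_AE)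
    fix r
    show "AE \<omega> in Q. (\<integral>\<^sup>+u. H (\<theta> (- u) \<omega>) u (S \<omega> r + u) \<partial>lborel) = G (- r) (T r \<omega>)"
      using AE_S_0[OF A] AE_space
    proof eventually_elim
      case (elim \<omega>)
      \<comment> \<open>Seen from \<open>T r \<omega>\<close>, the step -r leads back to position
        \<open>S \<omega> 0 - S \<omega> r\<close>, which is \<open>- S \<omega> r\<close> because
        \<open>S \<omega> 0 = 0\<close>. The shift of u by \<open>S \<omega> r\<close> then restores
        the frame of \<omega>.\<close>
      have "G (- r) (T r \<omega>) = (\<integral>\<^sup>+u. H (\<theta> (- (u - S \<omega> r)) \<omega>) (u - S \<omega> r) (S \<omega> r + (u - S \<omega> r)) \<partial>lborel)"
        using elim by (simp add: G_def S_T)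
      also have "\<dots> = (\<integral>\<^sup>+u. H (\<theta> (- u) \<omega>) u (S \<omega> r + u) \<partial>lborel)"
        using nn_integral_lborel_shift[of "\<lambda>u. H (\<theta> (- u) \<omega>) u (S \<omega> r + u)" "- S \<omega> r"] elim
        by simp
      finally show ?case ..
    qed
  qed
  also have "\<dots> = (\<integral>\<^sup>+r. \<integral>\<^sup>+\<omega>. G (- r) \<omega> \<partial>Q \<partial>lborel)"
    using A by (intro nn_integral_cong nn_integral_T) auto
  also have "\<dots> = (\<integral>\<^sup>+r. \<integral>\<^sup>+\<omega>. G r \<omega> \<partial>Q \<partial>lborel)"
    by (rule nn_integral_lborel_minus[of "\<lambda>r. \<integral>\<^sup>+\<omega>. G r \<omega> \<partial>Q"]) measurable
  also have "\<dots> = (\<integral>\<^sup>+\<omega>. \<integral>\<^sup>+r. G r \<omega> \<partial>lborel \<partial>Q)"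
    by (intro QL.Fubini') measurable
  also have "\<dots> = (\<integral>\<^sup>+\<omega>. \<integral>\<^sup>+u. \<integral>\<^sup>+r. H (\<theta> (- u) \<omega>) (S \<omega> r + u) u \<partial>lborel \<partial>lborel \<partial>Q)"
    unfolding G_def by (rule nn_integral_cong, rule lborel_pair.Fubini') measurable
  also have "\<dots> = (\<integral>\<^sup>+\<omega>. \<integral>\<^sup>+u. \<integral>\<^sup>+v. H (\<theta> (- u) \<omega>) v u \<partial>\<xi> (\<theta> (- u) \<omega>) \<partial>lborel \<partial>Q)"
    by (intro nn_integral_cong kernel_eq[symmetric]) auto
  finally show "(\<integral>\<^sup>+\<omega>. \<integral>\<^sup>+u. \<integral>\<^sup>+v. H (\<theta> (- u) \<omega>) u v \<partial>\<xi> (\<theta> (- u) \<omega>) \<partial>lborel \<partial>Q) = \<dots>" .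
qed


lemma emeasure_kernel_shift:
  assumes "\<omega> \<in> space Q" "B \<in> sets borel"
  shows "emeasure (\<xi> (\<theta> (- u) \<omega>)) B = emeasure (\<xi> \<omega>) (translate B u)"
  using invariant[of \<omega> "translate B u" "- u"] assms by (simp add: translate_translate)

lemma emeasure_translate_finite:
  assumes "\<omega> \<in> space Q" "bounded C"
  shows "emeasure (\<xi> \<omega>) (translate C u) < \<infinity>"
proof -
  interpret l: line_measure "\<xi> \<omega>" using line assms(1) .
  obtain b where "C \<subseteq> {- b..b}"
    using assms(2) unfolding bounded_real abs_le_iff by (metis atLeastAtMost_iff minus_le_iff subsetI)
  then have "translate C u \<subseteq> {- b - u..b - u}" by (auto simp: translate_def)
  then have "emeasure (\<xi> \<omega>) (translate C u) \<le> emeasure (\<xi> \<omega>) {- b - u..b - u}"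
    by (intro emeasure_mono) auto
  then show ?thesis using l.finite_Icc le_less_trans by blast
qed

text \<open>In \<open>H\<close> the normalising mass depends on the frame only. After the exchange
  the inner integral runs over the free indicator of C and produces just this mass, which cancels
  where it is positive and finite.\<close>

lemma mass_stationary_if_mass_shift_invariant:
  assumes A: "mass_shift_invariant"
  shows "mass_stationary \<theta> Q \<xi>"
  unfolding mass_stationary_def
proof (intro allI impI)
  fix C :: "real set" and f :: "'a \<times> real \<Rightarrow> real"
  assume [measurable]: "C \<in> sets borel" and bounded: "bounded C"
    and null: "emeasure lborel (frontier C) = 0"
    and f [measurable]: "f \<in> borel_measurable (Q \<Otimes>\<^sub>M borel)"
  define H where "H \<eta> u v = indicator C u * (indicator C v / emeasure (\<xi> \<eta>) C) * ennreal (f (\<theta> v \<eta>, v))"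
    for \<eta> u v
  have H_meas: "(\<lambda>(\<eta>, u, v). H \<eta> u v) \<in> borel_measurable (Q \<Otimes>\<^sub>M borel \<Otimes>\<^sub>M borel)"
    unfolding H_def by measurable
  \<comment> \<open>An interior point u leaves room for \<open>{0..<e}\<close> inside C - u, and
    \<open>S \<omega> 0 = 0\<close> says that every interval starting at 0 has positive
    mass.\<close>
  have pos: "0 < emeasure (\<xi> \<omega>) (translate C u)"
    if \<omega>: "\<omega> \<in> space Q" "S \<omega> 0 = 0" and u: "u \<in> interior C" for \<omega> u
  proof -
    interpret l: line_measure "\<xi> \<omega>" using line \<omega>(1) .
    obtain e where e: "0 < e" "ball u e \<subseteq> C" using u by (auto simp: mem_interior)
    have "{0..<e} \<subseteq> translate C u"
    proof
      fix s assume "s \<in> {0..<e}"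
      then have "s + u \<in> ball u e" by (simp add: dist_real_def)
      with e(2) show "s \<in> translate C u" by (auto simp: translate_eq_vimage)
    qed
    then have "emeasure (\<xi> \<omega>) {0..<e} \<le> emeasure (\<xi> \<omega>) (translate C u)"
      by (intro emeasure_mono) auto
    moreover have "0 < F \<omega> e" using l.S_less_iff[of 0 e] \<omega>(2) e(1) by simp
    ultimately show ?thesis using e(1)
      by (simp add: l.emeasure_Ico_F) (meson ennreal_less_zero_iff less_le_trans)
  qed
  have "(\<integral>\<^sup>+\<omega>. \<integral>\<^sup>+u. \<integral>\<^sup>+s. indicator C u * (indicator (translate C u) s / emeasure (\<xi> \<omega>) (translate C u))
          * ennreal (f (\<theta> s \<omega>, s + u)) \<partial>\<xi> \<omega> \<partial>lborel \<partial>Q) =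
      (\<integral>\<^sup>+\<omega>. \<integral>\<^sup>+u. \<integral>\<^sup>+v. H (\<theta> (- u) \<omega>) u v \<partial>\<xi> (\<theta> (- u) \<omega>) \<partial>lborel \<partial>Q)"
  proof (rule nn_integral_cong, rule nn_integral_cong)
    fix \<omega> u assume \<omega>: "\<omega> \<in> space Q"
    have "H (\<theta> (- u) \<omega>) u \<in> borel_measurable borel"
      by (rule measurable_compose_uncurry3[OF H_meas]) (use \<omega> in auto)
    then have "(\<integral>\<^sup>+v. H (\<theta> (- u) \<omega>) u v \<partial>\<xi> (\<theta> (- u) \<omega>)) = (\<integral>\<^sup>+s. H (\<theta> (- u) \<omega>) u (s - - u) \<partial>\<xi> \<omega>)"
      by (rule nn_integral_kernel_shift[OF \<omega>])
    then show "(\<integral>\<^sup>+s. indicator C u * (indicator (translate C u) s / emeasure (\<xi> \<omega>) (translate C u))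
          * ennreal (f (\<theta> s \<omega>, s + u)) \<partial>\<xi> \<omega>) = (\<integral>\<^sup>+v. H (\<theta> (- u) \<omega>) u v \<partial>\<xi> (\<theta> (- u) \<omega>))"
      using \<omega> by (simp add: H_def emeasure_kernel_shift indicator_translate)
  qed
  also have "\<dots> = (\<integral>\<^sup>+\<omega>. \<integral>\<^sup>+u. \<integral>\<^sup>+v. H (\<theta> (- u) \<omega>) v u \<partial>\<xi> (\<theta> (- u) \<omega>) \<partial>lborel \<partial>Q)"
    using exchange_if_mass_shift_invariant[OF A] H_meas unfolding exchange_def by blast
  also have "\<dots> = (\<integral>\<^sup>+\<omega>. \<integral>\<^sup>+u. indicator C u * ennreal (f (\<theta> 0 \<omega>, u)) \<partial>lborel \<partial>Q)"
  proof (rule nn_integral_cong_AE)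
    \<comment> \<open>Points of C outside the interior may see no mass; they lie in the frontier,
      which is a Lebesgue null set.\<close>
    have "AE u in lborel. u \<notin> frontier C"
      using null by (intro AE_not_in) (auto simp: null_sets_def)
    show "AE \<omega> in Q. (\<integral>\<^sup>+u. \<integral>\<^sup>+v. H (\<theta> (- u) \<omega>) v u \<partial>\<xi> (\<theta> (- u) \<omega>) \<partial>lborel) =
        (\<integral>\<^sup>+u. indicator C u * ennreal (f (\<theta> 0 \<omega>, u)) \<partial>lborel)"
      using AE_S_0[OF A] AE_space
    proof eventually_elim
      case (elim \<omega>)
      show ?case
      proof (rule nn_integral_cong_AE)
        show "AE u in lborel. (\<integral>\<^sup>+v. H (\<theta> (- u) \<omega>) v u \<partial>\<xi> (\<theta> (- u) \<omega>)) =
            indicator C u * ennreal (f (\<theta> 0 \<omega>, u))"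
          using \<open>AE u in lborel. u \<notin> frontier C\<close>
        proof eventually_elim
          fix u assume u: "u \<notin> frontier C"
          let ?m = "emeasure (\<xi> \<omega>) (translate C u)"
          interpret l: line_measure "\<xi> (\<theta> (- u) \<omega>)" using line elim by simp
          have "(\<integral>\<^sup>+v. H (\<theta> (- u) \<omega>) v u \<partial>\<xi> (\<theta> (- u) \<omega>)) =
              (\<integral>\<^sup>+v. (indicator C u / ?m * ennreal (f (\<theta> 0 \<omega>, u))) * indicator C v \<partial>\<xi> (\<theta> (- u) \<omega>))"
            using elim by (simp add: H_def emeasure_kernel_shift mult_ac)
          also have "\<dots> = indicator C u / ?m * ennreal (f (\<theta> 0 \<omega>, u)) * ?m"
            using elim by (simp add: nn_integral_cmult emeasure_kernel_shift)
          also have "\<dots> = indicator C u * ennreal (f (\<theta> 0 \<omega>, u))"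
          proof (cases "u \<in> C")
            case True
            with u have "u \<in> interior C" using closure_subset by (auto simp: frontier_def)
            then have "0 < ?m" using pos elim by simp
            moreover have "?m < \<infinity>" using emeasure_translate_finite bounded elim by simp
            ultimately have "1 / ?m * ?m = 1"
              by (simp add: ennreal_divide_times ennreal_divide_self)
            then show ?thesis using True by (simp add: mult_ac) (metis mult.assoc mult.commute mult_1)
          qed simp
          finally show "(\<integral>\<^sup>+v. H (\<theta> (- u) \<omega>) v u \<partial>\<xi> (\<theta> (- u) \<omega>)) =
            indicator C u * ennreal (f (\<theta> 0 \<omega>, u))" .
        qed
      qed
    qed
  qed
  finally show "(\<integral>\<^sup>+\<omega>. \<integral>\<^sup>+u. \<integral>\<^sup>+s. indicator C u * (indicator (translate C u) s / emeasure (\<xi> \<omega>) (translate C u))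
          * ennreal (f (\<theta> s \<omega>, s + u)) \<partial>\<xi> \<omega> \<partial>lborel \<partial>Q) =
      (\<integral>\<^sup>+\<omega>. \<integral>\<^sup>+u. indicator C u * ennreal (f (\<theta> 0 \<omega>, u)) \<partial>lborel \<partial>Q)" .
qed

end

section \<open>From mass-stationarity to invariance by growing windows\<close>

lemma emeasure_frontier_Icc: "emeasure lborel (frontier {a..b::real}) = 0"
proof -
  have "frontier {a..b} = {a..b} - {a<..<b}"
    unfolding frontier_def interior_atLeastAtMost_real by (simp add: closure_closed)
  also have "\<dots> \<subseteq> {a, b}" by force
  finally have "countable (frontier {a..b})"
    by (rule countable_subset) (intro countable_finite finite.intros)
  then show ?thesis by (rule emeasure_lborel_countable)
qed

text \<open>A window of length 2N and its translate by s overlap in length 2N - |s|. For larger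
  shifts this is negative, and the truncation by \<open>ennreal\<close> gives the correct value
  0.\<close>

lemma nn_integral_indicator_overlap:
  fixes N s :: real
  assumes "N > 0"
  shows "(\<integral>\<^sup>+u. indicator {-N..N} u * indicator {-N..N} (u + s) \<partial>lborel) =
    ennreal (2 * N) * ennreal (1 - \<bar>s\<bar> / (2 * N))"
proof -
  have "(\<integral>\<^sup>+u. indicator {-N..N} u * indicator {-N..N} (u + s) \<partial>lborel) =
      (\<integral>\<^sup>+u. indicator {max (-N) (-N - s)..min N (N - s)} u \<partial>lborel)"
    by (intro nn_integral_cong) (auto simp: indicator_def)
  also have "\<dots> = ennreal (min N (N - s) - max (-N) (-N - s))"
    by (cases "max (-N) (-N - s) \<le> min N (N - s)") (auto simp: ennreal_neg)
  also have "min N (N - s) - max (-N) (-N - s) = 2 * N - \<bar>s\<bar>"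
    by (simp add: min_def max_def)
  also have "\<dots> = 2 * N * (1 - \<bar>s\<bar> / (2 * N))"
    using assms by (simp add: right_diff_distrib)
  also have "ennreal \<dots> = ennreal (2 * N) * ennreal (1 - \<bar>s\<bar> / (2 * N))"
    using assms by (intro ennreal_mult') auto
  finally show ?thesis .
qed

text \<open>The weights increase to 1 pointwise, so monotone convergence applies even when the limit
  integral is infinite.\<close>

lemma nn_integral_window_weight_LIMSEQ:
  fixes g :: "'a \<Rightarrow> ennreal" and s :: "'a \<Rightarrow> real"
  assumes [measurable]: "g \<in> borel_measurable M" "s \<in> borel_measurable M"
  shows "(\<lambda>n. \<integral>\<^sup>+x. g x * ennreal (1 - \<bar>s x\<bar> / (2 * real (Suc n))) \<partial>M) \<longlonglongrightarrow> (\<integral>\<^sup>+x. g x \<partial>M)"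
proof (rule nn_integral_LIMSEQ)
  show "incseq (\<lambda>n x. g x * ennreal (1 - \<bar>s x\<bar> / (2 * real (Suc n))))"
    by (intro monoI le_funI mult_left_mono ennreal_leI diff_left_mono divide_left_mono) auto
  fix x
  have "(\<lambda>n. 1 - \<bar>s x\<bar> / 2 * inverse (real (Suc n))) \<longlonglongrightarrow> 1 - \<bar>s x\<bar> / 2 * 0"
    by (intro tendsto_intros LIMSEQ_inverse_real_of_nat)
  then have "(\<lambda>n. ennreal (1 - \<bar>s x\<bar> / (2 * real (Suc n)))) \<longlonglongrightarrow> ennreal 1"
    by (intro tendsto_ennrealI) (simp add: field_simps)
  then have "(\<lambda>n. g x * ennreal (1 - \<bar>s x\<bar> / (2 * real (Suc n)))) \<longlonglongrightarrow> g x * ennreal 1"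
    by (intro tendsto_mult_ennreal tendsto_const) auto
  then show "(\<lambda>n. g x * ennreal (1 - \<bar>s x\<bar> / (2 * real (Suc n)))) \<longlonglongrightarrow> g x" by simp
qed measurable

context measured_flow_kernel
begin

text \<open>
  Testing mass-stationarity on the window \<open>C\<close> with \<open>f1\<close> and with \<open>f2\<close> gives the same
  left-hand side, by a shift by \<open>r\<close> in mass coordinates; the right-hand sides carry the weights
  \<open>\<lambda>(C \<inter> (C - S\<^sub>r))\<close> and \<open>\<lambda>(C \<inter> (C - S\<^sub>-\<^sub>r))\<close>, which
  normalised increase to 1 as \<open>C\<close> grows.
\<close>

lemma mass_shift_invariant_if_mass_stationary:
  assumes B: "mass_stationary \<theta> Q \<xi>"
  shows "mass_shift_invariant"
  unfolding mass_shift_invariant_def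
proof (intro allI measure_eqI)
  fix r A
  assume "A \<in> sets (distr Q Q (T r))"
  then have A [measurable]: "A \<in> sets Q" by simp
  have weighted: "(\<integral>\<^sup>+\<omega>. indicator A (T r \<omega>) * ennreal (1 - \<bar>S \<omega> r\<bar> / (2 * N)) \<partial>Q) =
      (\<integral>\<^sup>+\<omega>. indicator A \<omega> * ennreal (1 - \<bar>S \<omega> (- r)\<bar> / (2 * N)) \<partial>Q)"
    if N: "N > 0" for N
  proof -
    define C where "C = {-N..N}"
    define f1 where "f1 = (\<lambda>(\<omega>, v). indicator A (T r \<omega>) * indicator C (v + S \<omega> r) :: real)"
    define f2 where "f2 = (\<lambda>(\<omega>, v). indicator A \<omega> * indicator C (v + S \<omega> (- r)) :: real)"
    have [measurable]: "C \<in> sets borel" by (simp add: C_def)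
    have f1 [measurable]: "f1 \<in> borel_measurable (Q \<Otimes>\<^sub>M borel)" unfolding f1_def by measurable
    have f2 [measurable]: "f2 \<in> borel_measurable (Q \<Otimes>\<^sub>M borel)" unfolding f2_def by measurable
    have ms: "(\<integral>\<^sup>+\<omega>. \<integral>\<^sup>+u. \<integral>\<^sup>+s. indicator C u * (indicator (translate C u) s / emeasure (\<xi> \<omega>) (translate C u))
          * ennreal (f (\<theta> s \<omega>, s + u)) \<partial>\<xi> \<omega> \<partial>lborel \<partial>Q) =
        (\<integral>\<^sup>+\<omega>. \<integral>\<^sup>+u. indicator C u * ennreal (f (\<theta> 0 \<omega>, u)) \<partial>lborel \<partial>Q)"
      if "f \<in> borel_measurable (Q \<Otimes>\<^sub>M borel)" "\<And>x. 0 \<le> f x" for f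
      using B[unfolded mass_stationary_def, rule_format, of C f] that N
      by (simp add: C_def emeasure_frontier_Icc)
    have rhs: "(\<integral>\<^sup>+\<omega>. \<integral>\<^sup>+u. indicator C u * ennreal (indicator A (g \<omega>) * indicator C (u + s \<omega>)) \<partial>lborel \<partial>Q) =
        ennreal (2 * N) * (\<integral>\<^sup>+\<omega>. indicator A (g \<omega>) * ennreal (1 - \<bar>s \<omega>\<bar> / (2 * N)) \<partial>Q)"
      if [measurable]: "g \<in> measurable Q Q" "s \<in> borel_measurable Q" for g s
    proof -
      have "(\<integral>\<^sup>+u. indicator C u * ennreal (indicator A (g \<omega>) * indicator C (u + s \<omega>)) \<partial>lborel) =
          ennreal (2 * N) * (indicator A (g \<omega>) * ennreal (1 - \<bar>s \<omega>\<bar> / (2 * N)))" for \<omega>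
      proof -
        have "(\<integral>\<^sup>+u. indicator C u * ennreal (indicator A (g \<omega>) * indicator C (u + s \<omega>)) \<partial>lborel) =
            (\<integral>\<^sup>+u. indicator A (g \<omega>) * (indicator C u * indicator C (u + s \<omega>)) \<partial>lborel)"
          by (intro nn_integral_cong) (auto simp: indicator_def)
        also have "\<dots> = indicator A (g \<omega>) * (\<integral>\<^sup>+u. indicator C u * indicator C (u + s \<omega>) \<partial>lborel)"
          by (intro nn_integral_cmult) measurable
        finally show ?thesis
          using N by (simp add: C_def nn_integral_indicator_overlap mult_ac)
      qed
      then show ?thesis by (simp add: nn_integral_cmult)
    qed
    have "ennreal (2 * N) * (\<integral>\<^sup>+\<omega>. indicator A (T r \<omega>) * ennreal (1 - \<bar>S \<omega> r\<bar> / (2 * N)) \<partial>Q) =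
        (\<integral>\<^sup>+\<omega>. \<integral>\<^sup>+u. indicator C u * ennreal (f1 (\<theta> 0 \<omega>, u)) \<partial>lborel \<partial>Q)"
      by (subst rhs[symmetric]) (auto simp: f1_def intro!: nn_integral_cong)
    also have "\<dots> = (\<integral>\<^sup>+\<omega>. \<integral>\<^sup>+u. \<integral>\<^sup>+s. indicator C u * (indicator (translate C u) s / emeasure (\<xi> \<omega>) (translate C u))
          * ennreal (f1 (\<theta> s \<omega>, s + u)) \<partial>\<xi> \<omega> \<partial>lborel \<partial>Q)"
      by (intro ms[symmetric] f1) (auto simp: f1_def)
    also have "\<dots> = (\<integral>\<^sup>+\<omega>. \<integral>\<^sup>+u. \<integral>\<^sup>+s. indicator C u * (indicator (translate C u) s / emeasure (\<xi> \<omega>) (translate C u))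
          * ennreal (f2 (\<theta> s \<omega>, s + u)) \<partial>\<xi> \<omega> \<partial>lborel \<partial>Q)"
    proof (rule nn_integral_cong, rule nn_integral_cong)
      fix \<omega> u assume \<omega> [measurable]: "\<omega> \<in> space Q"
      interpret l: line_measure "\<xi> \<omega>" using line \<omega> .
      let ?h = "\<lambda>f q. indicator C u * (indicator (translate C u) (S \<omega> q) / emeasure (\<xi> \<omega>) (translate C u))
          * ennreal (f (T q \<omega>, S \<omega> q + u))"
      have h: "(\<integral>\<^sup>+s. indicator C u * (indicator (translate C u) s / emeasure (\<xi> \<omega>) (translate C u))
          * ennreal (f (\<theta> s \<omega>, s + u)) \<partial>\<xi> \<omega>) = (\<integral>\<^sup>+q. ?h f q \<partial>lborel)"
        if [measurable]: "f \<in> borel_measurable (Q \<Otimes>\<^sub>M borel)" for f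
        using \<omega> by (intro nn_integral_kernel) auto
      have "(\<lambda>q. ?h f2 q) \<in> borel_measurable borel" by measurable
      then have "(\<integral>\<^sup>+q. ?h f2 q \<partial>lborel) = (\<integral>\<^sup>+q. ?h f2 (q + r) \<partial>lborel)"
        by (rule nn_integral_lborel_shift[symmetric])
      \<comment> \<open>Translating q by r interchanges the two window indicators: one tests
        \<open>S \<omega> q + u\<close>, the other \<open>S \<omega> (q + r) + u\<close>, and the
        cocycle identity turns each into the other's role. The normalising mass depends on u only
        and is not affected.\<close>
      also have "\<dots> = (\<integral>\<^sup>+q. ?h f1 q \<partial>lborel)"
        using \<omega> by (intro nn_integral_cong)
          (auto simp: f1_def f2_def S_T translate_eq_vimage indicator_def add_ac)
      finally show "(\<integral>\<^sup>+s. indicator C u * (indicator (translate C u) s / emeasure (\<xi> \<omega>) (translate C u))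
          * ennreal (f1 (\<theta> s \<omega>, s + u)) \<partial>\<xi> \<omega>) =
         (\<integral>\<^sup>+s. indicator C u * (indicator (translate C u) s / emeasure (\<xi> \<omega>) (translate C u))
          * ennreal (f2 (\<theta> s \<omega>, s + u)) \<partial>\<xi> \<omega>)"
        by (simp only: h[OF f1] h[OF f2])
    qed
    also have "\<dots> = (\<integral>\<^sup>+\<omega>. \<integral>\<^sup>+u. indicator C u * ennreal (f2 (\<theta> 0 \<omega>, u)) \<partial>lborel \<partial>Q)"
      by (intro ms f2) (auto simp: f2_def)
    also have "\<dots> = ennreal (2 * N) * (\<integral>\<^sup>+\<omega>. indicator A \<omega> * ennreal (1 - \<bar>S \<omega> (- r)\<bar> / (2 * N)) \<partial>Q)"
      by (subst rhs[symmetric]) (auto simp: f2_def intro!: nn_integral_cong)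
    finally show ?thesis using N by (simp add: ennreal_mult_cancel_left)
  qed
  have "(\<integral>\<^sup>+\<omega>. indicator A (T r \<omega>) \<partial>Q) = (\<integral>\<^sup>+\<omega>. indicator A \<omega> \<partial>Q)"
  proof (rule LIMSEQ_unique)
    show "(\<lambda>n. \<integral>\<^sup>+\<omega>. indicator A (T r \<omega>) * ennreal (1 - \<bar>S \<omega> r\<bar> / (2 * real (Suc n))) \<partial>Q)
        \<longlonglongrightarrow> (\<integral>\<^sup>+\<omega>. indicator A (T r \<omega>) \<partial>Q)"
      by (rule nn_integral_window_weight_LIMSEQ) measurable
    show "(\<lambda>n. \<integral>\<^sup>+\<omega>. indicator A (T r \<omega>) * ennreal (1 - \<bar>S \<omega> r\<bar> / (2 * real (Suc n))) \<partial>Q)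
        \<longlonglongrightarrow> (\<integral>\<^sup>+\<omega>. indicator A \<omega> \<partial>Q)"
      by (subst weighted, simp, rule nn_integral_window_weight_LIMSEQ) measurable
  qed
  moreover have "(\<integral>\<^sup>+\<omega>. indicator A (T r \<omega>) \<partial>Q) = (\<integral>\<^sup>+\<omega>. indicator A \<omega> \<partial>distr Q Q (T r))"
    by (intro nn_integral_distr[symmetric]) measurable
  ultimately show "emeasure (distr Q Q (T r)) A = emeasure Q A"
    by simp
qed simp

end

subsection \<open>Palm measures and the inversion formula\<close>

text \<open>Markov's inequality bounds the measure of the sets where \<open>1 \<le> n * g\<close>,
  and these exhaust the space by positivity.\<close>

lemma sigma_finite_measure_if_positive_integrable:
  assumes [measurable]: "g \<in> borel_measurable M" and fin: "(\<integral>\<^sup>+x. g x \<partial>M) < \<infinity>"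
    and pos: "\<And>x. x \<in> space M \<Longrightarrow> 0 < g x"
  shows "sigma_finite_measure M"
proof
  let ?A = "\<lambda>n::nat. {x \<in> space M. 1 \<le> of_nat n * g x}"
  have "emeasure M (?A n) \<noteq> \<infinity>" for n
  proof -
    have "emeasure M (?A n) \<le> of_nat n * (\<integral>\<^sup>+x. g x * indicator (space M) x \<partial>M)"
      by (rule nn_integral_Markov_inequality) auto
    also have "(\<integral>\<^sup>+x. g x * indicator (space M) x \<partial>M) = (\<integral>\<^sup>+x. g x \<partial>M)"
      by (intro nn_integral_cong) auto
    also have "of_nat n * (\<integral>\<^sup>+x. g x \<partial>M) < \<infinity>"
      using fin by (simp add: ennreal_mult_less_top of_nat_less_top)
    finally show ?thesis by simp
  qed
  moreover have "(\<Union>n. ?A n) = space M"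
  proof -
    have "\<exists>n::nat. 1 \<le> of_nat n * g x" if x: "x \<in> space M" for x
    proof (cases "g x = \<infinity>")
      case True
      then show ?thesis by (intro exI[of _ 1]) simp
    next
      case False
      then obtain y where y: "g x = ennreal y" "0 < y"
        using pos[OF x] by (cases "g x") auto
      obtain n where "1 / y < real n" using reals_Archimedean2 by blast
      then have "1 \<le> real n * y" using y(2) by (simp add: field_simps)
      then have "1 \<le> of_nat n * g x"
        using y by (simp add: ennreal_of_nat_eq_real_of_nat ennreal_mult'[symmetric])
      then show ?thesis ..
    qed
    then show ?thesis by auto
  qed
  ultimately show "\<exists>A. countable A \<and> A \<subseteq> sets M \<and> \<Union> A = space M \<and> (\<forall>a\<in>A. emeasure M a \<noteq> \<infinity>)"
    by (intro exI[of _ "range ?A"]) auto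
qed

lemma AE_lborel_neq: "AE u in lborel. u \<noteq> (c::real)"
  using AE_not_in[of "{c}" lborel] by (simp add: null_sets_def)

section \<open>Construction of the stationary measure from Q\<close>

context measured_flow_kernel
begin

text \<open>The uniform density on the stretch of mass w just before the origin. For \<eta> =
  \<open>\<theta> (- u) \<omega>\<close> with \<open>S \<omega> 0 = 0\<close> the condition on
  \<open>F \<eta> u\<close> says that -u lies in (0, \<open>S \<omega> w\<close>]; this is where the
  range of integration in the inversion formula comes from.\<close>

definition mass_weight :: "real \<Rightarrow> 'a \<Rightarrow> real \<Rightarrow> ennreal" where
  "mass_weight w \<eta> u = ennreal (inverse w) * indicator {- w..<0} (F \<eta> u)"

lemma mass_weight_measurable [measurable (raw)]:
  assumes [measurable]: "f \<in> measurable N Q" "u \<in> borel_measurable N"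
  shows "(\<lambda>x. mass_weight w (f x) (u x)) \<in> borel_measurable N"
  unfolding mass_weight_def by measurable

lemma nn_integral_mass_weight:
  assumes [measurable]: "\<eta> \<in> space Q" and "w > 0"
  shows "(\<integral>\<^sup>+u. mass_weight w \<eta> u \<partial>\<xi> \<eta>) = 1"
proof -
  interpret l: line_measure "\<xi> \<eta>" using line assms(1) .
  have "(\<integral>\<^sup>+u. mass_weight w \<eta> u \<partial>\<xi> \<eta>) = (\<integral>\<^sup>+r. ennreal (inverse w) * indicator {- w..<0} r \<partial>lborel)"
    using assms by (subst nn_integral_kernel) (auto simp: mass_weight_def)
  also have "\<dots> = 1"
    using assms(2) by (simp add: nn_integral_cmult ennreal_mult'[symmetric])
  finally show ?thesis .
qed

text \<open>Exchange applied to the product of k in u and \<Phi> in v: on the other side k is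
  integrated against \<xi> and contributes the factor 1. The result no longer depends on k, which is
  the source of both stationarity and the Campbell formula.\<close>

lemma exchange_weights:
  assumes ex: "exchange"
    and k: "(\<lambda>(\<eta>, u). k \<eta> u) \<in> borel_measurable (Q \<Otimes>\<^sub>M borel)"
      "\<And>\<eta>. \<eta> \<in> space Q \<Longrightarrow> (\<integral>\<^sup>+u. k \<eta> u \<partial>\<xi> \<eta>) = 1"
    and \<Phi>: "(\<lambda>(\<eta>, u). \<Phi> \<eta> u) \<in> borel_measurable (Q \<Otimes>\<^sub>M borel)"
  shows "(\<integral>\<^sup>+\<omega>. \<integral>\<^sup>+u. k (\<theta> (- u) \<omega>) u * (\<integral>\<^sup>+v. \<Phi> (\<theta> (- u) \<omega>) v \<partial>\<xi> (\<theta> (- u) \<omega>)) \<partial>lborel \<partial>Q) =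
    (\<integral>\<^sup>+\<omega>. \<integral>\<^sup>+u. \<Phi> (\<theta> (- u) \<omega>) u \<partial>lborel \<partial>Q)"
proof -
  have [measurable (raw)]: "(\<lambda>x. k (f x) (a x)) \<in> borel_measurable N"
    "(\<lambda>x. \<Phi> (f x) (a x)) \<in> borel_measurable N"
    if "f \<in> measurable N Q" "a \<in> borel_measurable N" for f a and N :: "'c measure"
    by (rule measurable_compose_uncurry[OF k(1) that], rule measurable_compose_uncurry[OF \<Phi> that])
  have "(\<lambda>(\<eta>, u, v). k \<eta> u * \<Phi> \<eta> v) \<in> borel_measurable (Q \<Otimes>\<^sub>M borel \<Otimes>\<^sub>M borel)"
    by measurable
  note ex = ex[unfolded exchange_def, rule_format, OF this]
  have line': "sets (\<xi> (\<theta> (- u) \<omega>)) = sets borel" if "\<omega> \<in> space Q" for \<omega> u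
    using line_measure.sets_eq[OF line] that by simp
  have "(\<integral>\<^sup>+\<omega>. \<integral>\<^sup>+u. k (\<theta> (- u) \<omega>) u * (\<integral>\<^sup>+v. \<Phi> (\<theta> (- u) \<omega>) v \<partial>\<xi> (\<theta> (- u) \<omega>)) \<partial>lborel \<partial>Q) =
      (\<integral>\<^sup>+\<omega>. \<integral>\<^sup>+u. \<integral>\<^sup>+v. k (\<theta> (- u) \<omega>) u * \<Phi> (\<theta> (- u) \<omega>) v \<partial>\<xi> (\<theta> (- u) \<omega>) \<partial>lborel \<partial>Q)"
    using line' by (intro nn_integral_cong nn_integral_cmult[symmetric])
      (simp cong: measurable_cong_sets)
  also have "\<dots> = (\<integral>\<^sup>+\<omega>. \<integral>\<^sup>+u. \<integral>\<^sup>+v. k (\<theta> (- u) \<omega>) v * \<Phi> (\<theta> (- u) \<omega>) u \<partial>\<xi> (\<theta> (- u) \<omega>) \<partial>lborel \<partial>Q)"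
    by (rule ex)
  also have "\<dots> = (\<integral>\<^sup>+\<omega>. \<integral>\<^sup>+u. \<Phi> (\<theta> (- u) \<omega>) u \<partial>lborel \<partial>Q)"
  proof (rule nn_integral_cong, rule nn_integral_cong)
    fix \<omega> u assume "\<omega> \<in> space Q"
    then show "(\<integral>\<^sup>+v. k (\<theta> (- u) \<omega>) v * \<Phi> (\<theta> (- u) \<omega>) u \<partial>\<xi> (\<theta> (- u) \<omega>)) = \<Phi> (\<theta> (- u) \<omega>) u"
      using line' by (subst nn_integral_multc) (simp_all add: k(2) cong: measurable_cong_sets)
  qed
  finally show ?thesis .
qed

text \<open>Any other weight of unit mass would yield the same measure.\<close>

definition inversion :: "'a measure" where
  "inversion = distr (density (Q \<Otimes>\<^sub>M lborel) (\<lambda>(\<omega>, u). mass_weight 1 (\<theta> (- u) \<omega>) u)) Q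
     (\<lambda>(\<omega>, u). \<theta> (- u) \<omega>)"

lemma sets_inversion [measurable_cong, simp]: "sets inversion = sets Q"
  by (simp add: inversion_def)

lemma space_inversion [simp]: "space inversion = space Q"
  by (simp add: inversion_def)

lemma nn_integral_inversion:
  assumes [measurable]: "f \<in> borel_measurable Q"
  shows "(\<integral>\<^sup>+\<eta>. f \<eta> \<partial>inversion) =
    (\<integral>\<^sup>+\<omega>. \<integral>\<^sup>+u. mass_weight 1 (\<theta> (- u) \<omega>) u * f (\<theta> (- u) \<omega>) \<partial>lborel \<partial>Q)"
proof -
  have "(\<integral>\<^sup>+\<eta>. f \<eta> \<partial>inversion) =
      (\<integral>\<^sup>+x. mass_weight 1 (\<theta> (- snd x) (fst x)) (snd x) * f (\<theta> (- snd x) (fst x)) \<partial>(Q \<Otimes>\<^sub>M lborel))"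
    unfolding inversion_def by (subst nn_integral_distr) (auto simp: nn_integral_density case_prod_beta')
  also have "\<dots> = (\<integral>\<^sup>+\<omega>. \<integral>\<^sup>+u. mass_weight 1 (\<theta> (- u) \<omega>) u * f (\<theta> (- u) \<omega>) \<partial>lborel \<partial>Q)"
    by (subst lborel.nn_integral_fst[symmetric]) auto
  finally show ?thesis .
qed

lemma refined_Campbell_inversion:
  assumes "exchange" and [measurable]: "(\<lambda>(\<eta>, u). \<Phi> \<eta> u) \<in> borel_measurable (Q \<Otimes>\<^sub>M borel)"
  shows "(\<integral>\<^sup>+\<eta>. \<integral>\<^sup>+v. \<Phi> \<eta> v \<partial>\<xi> \<eta> \<partial>inversion) = (\<integral>\<^sup>+\<omega>. \<integral>\<^sup>+u. \<Phi> (\<theta> (- u) \<omega>) u \<partial>lborel \<partial>Q)"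
  by (subst nn_integral_inversion, measurable, rule exchange_weights)
    (auto simp: nn_integral_mass_weight assms)

text \<open>A shift by t only replaces the weight in the definition of \<open>inversion\<close> by
  another one of unit mass, to which the measure is insensitive.\<close>

lemma stationary_inversion:
  assumes ex: "exchange"
  shows "stationary \<theta> inversion"
  unfolding stationary_def
proof (intro allI measure_eqI)
  fix t A assume "A \<in> sets (distr inversion inversion (\<theta> t))"
  then have [measurable]: "A \<in> sets Q" by simp
  \<comment> \<open>The weight as it appears after u has been shifted by t and the frame has been
    moved back by -t.\<close>
  define k where "k \<eta> u = mass_weight 1 (\<theta> (- t) \<eta>) (u + t)" for \<eta> u
  have k_meas: "(\<lambda>(\<eta>, u). k \<eta> u) \<in> borel_measurable (Q \<Otimes>\<^sub>M borel)"
    unfolding k_def by measurable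
  have k_mass: "(\<integral>\<^sup>+u. k \<eta> u \<partial>\<xi> \<eta>) = 1" if "\<eta> \<in> space Q" for \<eta>
    using nn_integral_kernel_shift[OF that, of "mass_weight 1 (\<theta> (- t) \<eta>)" "- t"] that
    by (simp add: k_def nn_integral_mass_weight)
  have [measurable]: "\<theta> t \<in> measurable inversion inversion"
    by measurable
  have "emeasure (distr inversion inversion (\<theta> t)) A = (\<integral>\<^sup>+\<eta>. indicator A \<eta> \<partial>distr inversion inversion (\<theta> t))"
    by simp
  also have "\<dots> = (\<integral>\<^sup>+\<eta>. indicator A (\<theta> t \<eta>) \<partial>inversion)"
    by (rule nn_integral_distr) auto
  also have "\<dots> = (\<integral>\<^sup>+\<omega>. \<integral>\<^sup>+u. mass_weight 1 (\<theta> (- u) \<omega>) u * indicator A (\<theta> t (\<theta> (- u) \<omega>)) \<partial>lborel \<partial>Q)"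
    by (rule nn_integral_inversion) auto
  also have "\<dots> = (\<integral>\<^sup>+\<omega>. \<integral>\<^sup>+u. k (\<theta> (- u) \<omega>) u * indicator A (\<theta> (- u) \<omega>) \<partial>lborel \<partial>Q)"
  proof (rule nn_integral_cong)
    fix \<omega> assume [measurable]: "\<omega> \<in> space Q"
    have "(\<integral>\<^sup>+u. mass_weight 1 (\<theta> (- u) \<omega>) u * indicator A (\<theta> t (\<theta> (- u) \<omega>)) \<partial>lborel) =
        (\<integral>\<^sup>+u. mass_weight 1 (\<theta> (- (u + t)) \<omega>) (u + t) * indicator A (\<theta> t (\<theta> (- (u + t)) \<omega>)) \<partial>lborel)"
      by (rule nn_integral_lborel_shift[symmetric]) measurable
    then show "(\<integral>\<^sup>+u. mass_weight 1 (\<theta> (- u) \<omega>) u * indicator A (\<theta> t (\<theta> (- u) \<omega>)) \<partial>lborel) =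
        (\<integral>\<^sup>+u. k (\<theta> (- u) \<omega>) u * indicator A (\<theta> (- u) \<omega>) \<partial>lborel)"
      using \<open>\<omega> \<in> space Q\<close> by (simp add: k_def minus_diff_commute[of t])
  qed
  \<comment> \<open>The factor 1 is inserted as the total mass of the original weight, which brings
    the integral into the form required by \<open>exchange_weights\<close>.\<close>
  also have "\<dots> = (\<integral>\<^sup>+\<omega>. \<integral>\<^sup>+u. k (\<theta> (- u) \<omega>) u *
      (\<integral>\<^sup>+v. mass_weight 1 (\<theta> (- u) \<omega>) v * indicator A (\<theta> (- u) \<omega>) \<partial>\<xi> (\<theta> (- u) \<omega>)) \<partial>lborel \<partial>Q)"
  proof (rule nn_integral_cong, rule nn_integral_cong)
    fix \<omega> u assume \<omega>: "\<omega> \<in> space Q"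
    interpret l: line_measure "\<xi> (\<theta> (- u) \<omega>)" using line \<omega> by simp
    show "k (\<theta> (- u) \<omega>) u * indicator A (\<theta> (- u) \<omega>) = k (\<theta> (- u) \<omega>) u *
      (\<integral>\<^sup>+v. mass_weight 1 (\<theta> (- u) \<omega>) v * indicator A (\<theta> (- u) \<omega>) \<partial>\<xi> (\<theta> (- u) \<omega>))"
      using \<omega> by (subst nn_integral_multc) (simp_all add: nn_integral_mass_weight)
  qed
  also have "\<dots> = (\<integral>\<^sup>+\<omega>. \<integral>\<^sup>+u. mass_weight 1 (\<theta> (- u) \<omega>) u * indicator A (\<theta> (- u) \<omega>) \<partial>lborel \<partial>Q)"
    by (rule exchange_weights[OF ex k_meas k_mass]) auto
  also have "\<dots> = (\<integral>\<^sup>+\<eta>. indicator A \<eta> \<partial>inversion)"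
    by (rule nn_integral_inversion[symmetric]) auto
  finally show "emeasure (distr inversion inversion (\<theta> t)) A = emeasure inversion A"
    by simp
qed simp

lemma palm_inversion:
  assumes "exchange"
  shows "is_palm_measure \<theta> inversion \<xi> Q"
  unfolding is_palm_measure_def
proof (intro conjI ballI)
  fix A assume "A \<in> sets inversion"
  then have [measurable]: "A \<in> sets Q" by simp
  have "(\<integral>\<^sup>+\<omega>. \<integral>\<^sup>+s. indicator {0..1} s * indicator A (\<theta> s \<omega>) \<partial>\<xi> \<omega> \<partial>inversion) =
      (\<integral>\<^sup>+\<omega>. \<integral>\<^sup>+u. indicator {0..1} u * indicator A (\<theta> u (\<theta> (- u) \<omega>)) \<partial>lborel \<partial>Q)"
    by (rule refined_Campbell_inversion[OF assms]) measurable
  also have "\<dots> = (\<integral>\<^sup>+\<omega>. indicator A \<omega> \<partial>Q)"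
    by (intro nn_integral_cong) (simp add: nn_integral_multc)
  finally show "emeasure Q A = (\<integral>\<^sup>+\<omega>. \<integral>\<^sup>+s. indicator {0..1} s * indicator A (\<theta> s \<omega>) \<partial>\<xi> \<omega> \<partial>inversion)"
    by simp
qed simp

text \<open>A strictly positive Q-integrable h and a strictly positive Lebesgue-integrable \<kappa>
  are combined along the orbit into \<open>K\<close>. The Campbell formula makes its integral the
  product of the two, and \<open>K\<close> is positive because every path carries mass.\<close>

lemma sigma_finite_inversion:
  assumes "exchange"
  shows "sigma_finite_measure inversion"
proof -
  obtain h where h [measurable]: "h \<in> borel_measurable Q" and h_fin: "integral\<^sup>N Q h \<noteq> \<infinity>"
    and h_pos: "\<forall>x\<in>space Q. 0 < h x \<and> h x < \<infinity>"
    using Ex_finite_integrable_function by blast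
  obtain \<kappa> :: "real \<Rightarrow> ennreal" where \<kappa> [measurable]: "\<kappa> \<in> borel_measurable lborel"
    and \<kappa>_fin: "integral\<^sup>N lborel \<kappa> \<noteq> \<infinity>" and \<kappa>_pos: "\<forall>x\<in>space lborel. 0 < \<kappa> x \<and> \<kappa> x < \<infinity>"
    using sigma_finite_measure.Ex_finite_integrable_function[OF sigma_finite_lborel] by blast
  have [measurable]: "\<kappa> \<in> borel_measurable borel" using \<kappa> by simp
  define K where "K \<eta> = (\<integral>\<^sup>+v. h (\<theta> v \<eta>) * \<kappa> v \<partial>\<xi> \<eta>)" for \<eta>
  show ?thesis
  proof (rule sigma_finite_measure_if_positive_integrable)
    show "K \<in> borel_measurable inversion"
      unfolding K_def by measurable
    have "(\<integral>\<^sup>+\<eta>. K \<eta> \<partial>inversion) = (\<integral>\<^sup>+\<omega>. \<integral>\<^sup>+u. h (\<theta> u (\<theta> (- u) \<omega>)) * \<kappa> u \<partial>lborel \<partial>Q)"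
      unfolding K_def by (rule refined_Campbell_inversion[OF assms]) measurable
    also have "\<dots> = (\<integral>\<^sup>+\<omega>. h \<omega> * (\<integral>\<^sup>+u. \<kappa> u \<partial>lborel) \<partial>Q)"
      by (intro nn_integral_cong) (simp add: nn_integral_cmult)
    also have "\<dots> = (\<integral>\<^sup>+\<omega>. h \<omega> \<partial>Q) * (\<integral>\<^sup>+u. \<kappa> u \<partial>lborel)"
      by (rule nn_integral_multc) measurable
    finally show "(\<integral>\<^sup>+\<eta>. K \<eta> \<partial>inversion) < \<infinity>"
      using h_fin \<kappa>_fin by (simp add: ennreal_mult_less_top top.not_eq_extremum)
    fix \<eta> assume "\<eta> \<in> space inversion"
    then have \<eta> [measurable]: "\<eta> \<in> space Q" by simp
    interpret l: line_measure "\<xi> \<eta>" using line \<eta> .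
    have "K \<eta> \<noteq> 0"
    proof
      assume "K \<eta> = 0"
      then have "AE v in \<xi> \<eta>. h (\<theta> v \<eta>) * \<kappa> v = 0"
        unfolding K_def by (subst (asm) nn_integral_0_iff_AE) auto
      then have "AE v in \<xi> \<eta>. False"
        using h_pos \<kappa>_pos \<eta> by (elim eventually_mono) (metis UNIV_I flow_space mult_eq_0_iff
            order_less_irrefl space_lborel space_borel)
      then have "emeasure (\<xi> \<eta>) (space (\<xi> \<eta>)) = 0"
        by (subst (asm) AE_iff_measurable[OF _ refl]) auto
      then show False by (simp add: l.emeasure_UNIV)
    qed
    then show "0 < K \<eta>" by (simp add: zero_less_iff_neq_zero)
  qed
qed

end

section \<open>The refined Campbell formula and its consequences for a given Palm pair\<close>

locale palm_pair = measured_flow_kernel Q \<xi> \<theta> + P: sigma_finite_measure P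
  for Q P :: "'a measure" and \<xi> :: "'a \<Rightarrow> real measure" and \<theta> :: "real \<Rightarrow> 'a \<Rightarrow> 'a" +
  assumes stationary: "stationary \<theta> P"
    and palm: "is_palm_measure \<theta> P \<xi> Q"
begin

lemma sets_P [measurable_cong, simp]: "sets P = sets Q"
  using palm by (simp add: is_palm_measure_def)

lemma space_P [simp]: "space P = space Q"
  using sets_P by (rule sets_eq_imp_space_eq)

sublocale PL: pair_sigma_finite P lborel ..

lemma nn_integral_flow:
  assumes [measurable]: "f \<in> borel_measurable Q"
  shows "(\<integral>\<^sup>+\<eta>. f (\<theta> t \<eta>) \<partial>P) = (\<integral>\<^sup>+\<eta>. f \<eta> \<partial>P)"
proof -
  have [measurable]: "\<theta> t \<in> measurable P P" by measurable
  have "(\<integral>\<^sup>+\<eta>. f \<eta> \<partial>distr P P (\<theta> t)) = (\<integral>\<^sup>+\<eta>. f (\<theta> t \<eta>) \<partial>P)"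
    by (rule nn_integral_distr) auto
  then show ?thesis using stationary by (simp add: stationary_def)
qed

text \<open>The Palm formula on sets identifies Q with the image measure \<open>?D\<close>; equality
  of measures then covers all integrands without an approximation by simple functions.\<close>

lemma nn_integral_palm:
  assumes [measurable]: "g \<in> borel_measurable Q"
  shows "(\<integral>\<^sup>+\<eta>. \<integral>\<^sup>+r. indicator {0..1} (S \<eta> r) * g (T r \<eta>) \<partial>lborel \<partial>P) = (\<integral>\<^sup>+\<omega>. g \<omega> \<partial>Q)"
proof -
  let ?D = "distr (density (P \<Otimes>\<^sub>M lborel) (\<lambda>(\<eta>, r). indicator {0..1} (S \<eta> r))) Q (\<lambda>(\<eta>, r). T r \<eta>)"
  have D: "(\<integral>\<^sup>+\<omega>. f \<omega> \<partial>?D) = (\<integral>\<^sup>+\<eta>. \<integral>\<^sup>+r. indicator {0..1} (S \<eta> r) * f (T r \<eta>) \<partial>lborel \<partial>P)"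
    if [measurable]: "f \<in> borel_measurable Q" for f :: "'a \<Rightarrow> ennreal"
  proof -
    have "(\<integral>\<^sup>+\<omega>. f \<omega> \<partial>?D) = (\<integral>\<^sup>+x. indicator {0..1} (S (fst x) (snd x)) * f (T (snd x) (fst x)) \<partial>(P \<Otimes>\<^sub>M lborel))"
      by (subst nn_integral_distr) (auto simp: nn_integral_density case_prod_beta')
    also have "\<dots> = (\<integral>\<^sup>+\<eta>. \<integral>\<^sup>+r. indicator {0..1} (S \<eta> r) * f (T r \<eta>) \<partial>lborel \<partial>P)"
      by (subst lborel.nn_integral_fst[symmetric]) auto
    finally show ?thesis .
  qed
  have "Q = ?D"
  proof (rule measure_eqI)
    fix A assume A [measurable]: "A \<in> sets Q"
    have "emeasure Q A = (\<integral>\<^sup>+\<eta>. \<integral>\<^sup>+s. indicator {0..1} s * indicator A (\<theta> s \<eta>) \<partial>\<xi> \<eta> \<partial>P)"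
      using palm A by (simp add: is_palm_measure_def)
    also have "\<dots> = (\<integral>\<^sup>+\<eta>. \<integral>\<^sup>+r. indicator {0..1} (S \<eta> r) * indicator A (T r \<eta>) \<partial>lborel \<partial>P)"
      by (intro nn_integral_cong nn_integral_kernel) auto
    also have "\<dots> = (\<integral>\<^sup>+\<omega>. indicator A \<omega> \<partial>?D)"
      by (rule D[symmetric]) measurable
    finally show "emeasure Q A = emeasure ?D A" by simp
  qed simp
  then show ?thesis using D[of g] by simp
qed

text \<open>The Palm formula only sees positions in the unit interval. Averaging over all translates
  of that interval and moving each back to the origin by stationarity removes the
  restriction.\<close>

lemma refined_Campbell:
  assumes h: "(\<lambda>(\<omega>, u). h \<omega> u) \<in> borel_measurable (Q \<Otimes>\<^sub>M borel)"
  shows "(\<integral>\<^sup>+\<eta>. \<integral>\<^sup>+r. h (T r \<eta>) (S \<eta> r) \<partial>lborel \<partial>P) = (\<integral>\<^sup>+\<omega>. \<integral>\<^sup>+u. h \<omega> u \<partial>lborel \<partial>Q)"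
proof -
  have [measurable (raw)]: "(\<lambda>x. h (f x) (a x)) \<in> borel_measurable N"
    if "f \<in> measurable N Q" "a \<in> borel_measurable N" for f a and N :: "'c measure"
    by (rule measurable_compose_uncurry[OF h that])
  \<comment> \<open>The translates of \<open>{0..1}\<close> by t cover each position for a set of t
    of length 1.\<close>
  have unit: "(\<integral>\<^sup>+t. indicator {0..1} (x - t) \<partial>lborel) = (1::ennreal)" for x :: real
  proof -
    have "(\<integral>\<^sup>+t. indicator {0..1} (x - t) \<partial>lborel) = (\<integral>\<^sup>+t. indicator {x - 1..x} t \<partial>lborel)"
      by (intro nn_integral_cong) (auto simp: indicator_def)
    then show ?thesis by simp
  qed
  have "(\<integral>\<^sup>+\<eta>. \<integral>\<^sup>+r. h (T r \<eta>) (S \<eta> r) \<partial>lborel \<partial>P) =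
      (\<integral>\<^sup>+\<eta>. \<integral>\<^sup>+r. \<integral>\<^sup>+t. h (T r \<eta>) (S \<eta> r) * indicator {0..1} (S \<eta> r - t) \<partial>lborel \<partial>lborel \<partial>P)"
    by (simp add: nn_integral_cmult unit)
  also have "\<dots> = (\<integral>\<^sup>+\<eta>. \<integral>\<^sup>+t. \<integral>\<^sup>+r. h (T r \<eta>) (S \<eta> r) * indicator {0..1} (S \<eta> r - t) \<partial>lborel \<partial>lborel \<partial>P)"
    by (rule nn_integral_cong, rule lborel_pair.Fubini') measurable
  also have "\<dots> = (\<integral>\<^sup>+t. \<integral>\<^sup>+\<eta>. \<integral>\<^sup>+r. h (T r \<eta>) (S \<eta> r) * indicator {0..1} (S \<eta> r - t) \<partial>lborel \<partial>P \<partial>lborel)"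
    by (rule PL.Fubini'[symmetric]) measurable
  also have "\<dots> = (\<integral>\<^sup>+t. \<integral>\<^sup>+\<eta>. \<integral>\<^sup>+r. h (T r \<eta>) (S \<eta> r + t) * indicator {0..1} (S \<eta> r) \<partial>lborel \<partial>P \<partial>lborel)"
  proof (rule nn_integral_cong)
    fix t
    let ?\<Psi> = "\<lambda>\<eta>. \<integral>\<^sup>+r. h (T r \<eta>) (S \<eta> r) * indicator {0..1} (S \<eta> r - t) \<partial>lborel"
    have "(\<integral>\<^sup>+\<eta>. ?\<Psi> \<eta> \<partial>P) = (\<integral>\<^sup>+\<eta>. ?\<Psi> (\<theta> (- t) \<eta>) \<partial>P)"
      by (rule nn_integral_flow[symmetric]) measurable
    also have "\<dots> = (\<integral>\<^sup>+\<eta>. \<integral>\<^sup>+r. h (T r \<eta>) (S \<eta> r + t) * indicator {0..1} (S \<eta> r) \<partial>lborel \<partial>P)"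
    proof (rule nn_integral_cong)
      fix \<eta> assume "\<eta> \<in> space P"
      then have \<eta> [measurable]: "\<eta> \<in> space Q" by simp
      \<comment> \<open>The shift by -t changes mass coordinates by the constant
        \<open>F \<eta> (- t)\<close>, which a translation of r absorbs.\<close>
      have "?\<Psi> (\<theta> (- t) \<eta>) = (\<integral>\<^sup>+r. h (T (r + F \<eta> (- t)) \<eta>) (S \<eta> (r + F \<eta> (- t)) + t) *
          indicator {0..1} (S \<eta> (r + F \<eta> (- t))) \<partial>lborel)"
        using \<eta> by (simp add: S_shift)
      also have "\<dots> = (\<integral>\<^sup>+r. h (T r \<eta>) (S \<eta> r + t) * indicator {0..1} (S \<eta> r) \<partial>lborel)"
        by (rule nn_integral_lborel_shift[where g = "\<lambda>r. h (T r \<eta>) (S \<eta> r + t) * indicator {0..1} (S \<eta> r)"])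
          measurable
      finally show "?\<Psi> (\<theta> (- t) \<eta>) = \<dots>" .
    qed
    finally show "(\<integral>\<^sup>+\<eta>. ?\<Psi> \<eta> \<partial>P) = \<dots>" .
  qed
  also have "\<dots> = (\<integral>\<^sup>+\<eta>. \<integral>\<^sup>+t. \<integral>\<^sup>+r. h (T r \<eta>) (S \<eta> r + t) * indicator {0..1} (S \<eta> r) \<partial>lborel \<partial>lborel \<partial>P)"
    by (rule PL.Fubini') measurable
  also have "\<dots> = (\<integral>\<^sup>+\<eta>. \<integral>\<^sup>+r. \<integral>\<^sup>+t. h (T r \<eta>) (S \<eta> r + t) * indicator {0..1} (S \<eta> r) \<partial>lborel \<partial>lborel \<partial>P)"
    by (rule nn_integral_cong, rule lborel_pair.Fubini') measurable
  also have "\<dots> = (\<integral>\<^sup>+\<eta>. \<integral>\<^sup>+r. indicator {0..1} (S \<eta> r) * (\<integral>\<^sup>+t. h (T r \<eta>) t \<partial>lborel) \<partial>lborel \<partial>P)"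
  proof (rule nn_integral_cong, rule nn_integral_cong)
    fix \<eta> r assume "\<eta> \<in> space P"
    then have [measurable]: "\<eta> \<in> space Q" by simp
    have "(\<integral>\<^sup>+t. h (T r \<eta>) (S \<eta> r + t) * indicator {0..1} (S \<eta> r) \<partial>lborel) =
        indicator {0..1} (S \<eta> r) * (\<integral>\<^sup>+t. h (T r \<eta>) (t + S \<eta> r) \<partial>lborel)"
      by (subst nn_integral_cmult[symmetric]) (auto simp: mult_ac add_ac)
    also have "(\<integral>\<^sup>+t. h (T r \<eta>) (t + S \<eta> r) \<partial>lborel) = (\<integral>\<^sup>+t. h (T r \<eta>) t \<partial>lborel)"
      by (rule nn_integral_lborel_shift) measurable
    finally show "(\<integral>\<^sup>+t. h (T r \<eta>) (S \<eta> r + t) * indicator {0..1} (S \<eta> r) \<partial>lborel) =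
        indicator {0..1} (S \<eta> r) * (\<integral>\<^sup>+t. h (T r \<eta>) t \<partial>lborel)" .
  qed
  also have "\<dots> = (\<integral>\<^sup>+\<omega>. \<integral>\<^sup>+u. h \<omega> u \<partial>lborel \<partial>Q)"
    by (rule nn_integral_palm) measurable
  finally show ?thesis .
qed

text \<open>An auxiliary position u, uniform on the unit interval, lifts the integral to P by the
  Campbell formula. There \<open>T r\<close> is a translation of the mass coordinate, and the
  formula is applied once more on the way back.\<close>

lemma mass_shift_invariant: "mass_shift_invariant"
  unfolding mass_shift_invariant_def
proof (intro allI measure_eqI)
  fix r A assume "A \<in> sets (distr Q Q (T r))"
  then have [measurable]: "A \<in> sets Q" by simp
  have "emeasure (distr Q Q (T r)) A = (\<integral>\<^sup>+\<omega>. indicator A \<omega> \<partial>distr Q Q (T r))"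
    by simp
  also have "\<dots> = (\<integral>\<^sup>+\<omega>. indicator A (T r \<omega>) \<partial>Q)"
    by (rule nn_integral_distr) auto
  also have "\<dots> = (\<integral>\<^sup>+\<omega>. \<integral>\<^sup>+u. indicator A (T r \<omega>) * indicator {0..1::real} u \<partial>lborel \<partial>Q)"
    by (simp add: nn_integral_cmult_indicator)
  also have "\<dots> = (\<integral>\<^sup>+\<eta>. \<integral>\<^sup>+q. indicator A (T r (T q \<eta>)) * indicator {0..1} (S \<eta> q) \<partial>lborel \<partial>P)"
    by (rule refined_Campbell[symmetric]) measurable
  \<comment> \<open>Once \<open>T q\<close> takes the place of \<open>T r (T q \<eta>)\<close>, the
    position tested is that of level q - r, expressed through the new point as
    \<open>S \<eta> q + S (T q \<eta>) (- r)\<close>.\<close>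
  also have "\<dots> = (\<integral>\<^sup>+\<eta>. \<integral>\<^sup>+q. indicator A (T q \<eta>) * indicator {0..1} (S \<eta> q + S (T q \<eta>) (- r)) \<partial>lborel \<partial>P)"
  proof (rule nn_integral_cong)
    fix \<eta> assume "\<eta> \<in> space P"
    then have \<eta> [measurable]: "\<eta> \<in> space Q" by simp
    have "(\<integral>\<^sup>+q. indicator A (T q \<eta>) * indicator {0..1} (S \<eta> q + S (T q \<eta>) (- r)) \<partial>lborel) =
      (\<integral>\<^sup>+q. indicator A (T (q + r) \<eta>) * indicator {0..1} (S \<eta> (q + r) + S (T (q + r) \<eta>) (- r)) \<partial>lborel)"
      by (rule nn_integral_lborel_shift[symmetric]) measurable
    also have "\<dots> = (\<integral>\<^sup>+q. indicator A (T r (T q \<eta>)) * indicator {0..1} (S \<eta> q) \<partial>lborel)"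
      using \<eta> by (simp add: S_T add_ac)
    finally show "(\<integral>\<^sup>+q. indicator A (T r (T q \<eta>)) * indicator {0..1} (S \<eta> q) \<partial>lborel) =
      (\<integral>\<^sup>+q. indicator A (T q \<eta>) * indicator {0..1} (S \<eta> q + S (T q \<eta>) (- r)) \<partial>lborel :: ennreal)" ..
  qed
  also have "\<dots> = (\<integral>\<^sup>+\<omega>. \<integral>\<^sup>+u. indicator A \<omega> * indicator {0..1} (u + S \<omega> (- r)) \<partial>lborel \<partial>Q)"
    by (rule refined_Campbell) measurable
  also have "\<dots> = (\<integral>\<^sup>+\<omega>. indicator A \<omega> \<partial>Q)"
  proof (rule nn_integral_cong)
    fix \<omega>
    have "(\<integral>\<^sup>+u. indicator {0..1} (u + S \<omega> (- r)) \<partial>lborel) = (\<integral>\<^sup>+u. indicator {0..1::real} u \<partial>lborel :: ennreal)"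
      by (rule nn_integral_lborel_shift) measurable
    then show "(\<integral>\<^sup>+u. indicator A \<omega> * indicator {0..1} (u + S \<omega> (- r)) \<partial>lborel) = (indicator A \<omega> :: ennreal)"
      by (simp add: nn_integral_cmult)
  qed
  finally show "emeasure (distr Q Q (T r)) A = emeasure Q A" by simp
qed simp

text \<open>The factor 1 is written as the \<xi>-integral of \<open>mass_weight w\<close>, which
  makes the Campbell formula applicable; the reflection of u then gives the forward orbit of
  \<omega>.\<close>

lemma nn_integral_stationary:
  assumes [measurable]: "f \<in> borel_measurable Q" and w: "w > 0"
  shows "(\<integral>\<^sup>+\<eta>. f \<eta> \<partial>P) =
    ennreal (inverse w) * (\<integral>\<^sup>+\<omega>. (\<integral>\<^sup>+s\<in>{0..S \<omega> w}. f (\<theta> s \<omega>) \<partial>lborel) \<partial>Q)"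
proof -
  have [measurable]: "Measurable.pred (Q \<Otimes>\<^sub>M borel) (\<lambda>x. snd x \<in> {0..S (fst x) w})"
    unfolding atLeastAtMost_iff by measurable
  have "(\<integral>\<^sup>+\<eta>. f \<eta> \<partial>P) = (\<integral>\<^sup>+\<eta>. \<integral>\<^sup>+r. f (\<theta> (- S \<eta> r) (T r \<eta>)) *
      mass_weight w (\<theta> (- S \<eta> r) (T r \<eta>)) (S \<eta> r) \<partial>lborel \<partial>P)"
  proof (rule nn_integral_cong)
    fix \<eta> assume "\<eta> \<in> space P"
    then have \<eta> [measurable]: "\<eta> \<in> space Q" by simp
    have "f \<eta> = f \<eta> * (\<integral>\<^sup>+u. mass_weight w \<eta> u \<partial>\<xi> \<eta>)"
      using \<eta> w by (simp add: nn_integral_mass_weight)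
    also have "\<dots> = f \<eta> * (\<integral>\<^sup>+r. mass_weight w \<eta> (S \<eta> r) \<partial>lborel)"
      using \<eta> by (subst nn_integral_kernel) auto
    also have "\<dots> = (\<integral>\<^sup>+r. f \<eta> * mass_weight w \<eta> (S \<eta> r) \<partial>lborel)"
      by (rule nn_integral_cmult[symmetric]) measurable
    finally show "f \<eta> = (\<integral>\<^sup>+r. f (\<theta> (- S \<eta> r) (T r \<eta>)) *
      mass_weight w (\<theta> (- S \<eta> r) (T r \<eta>)) (S \<eta> r) \<partial>lborel)"
      using \<eta> by simp
  qed
  also have "\<dots> = (\<integral>\<^sup>+\<omega>. \<integral>\<^sup>+u. f (\<theta> (- u) \<omega>) * mass_weight w (\<theta> (- u) \<omega>) u \<partial>lborel \<partial>Q)"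
    by (rule refined_Campbell) measurable
  also have "\<dots> = (\<integral>\<^sup>+\<omega>. ennreal (inverse w) * (\<integral>\<^sup>+s\<in>{0..S \<omega> w}. f (\<theta> s \<omega>) \<partial>lborel) \<partial>Q)"
  proof (rule nn_integral_cong_AE)
    show "AE \<omega> in Q. (\<integral>\<^sup>+u. f (\<theta> (- u) \<omega>) * mass_weight w (\<theta> (- u) \<omega>) u \<partial>lborel) =
        ennreal (inverse w) * (\<integral>\<^sup>+s\<in>{0..S \<omega> w}. f (\<theta> s \<omega>) \<partial>lborel)"
      using AE_S_0[OF mass_shift_invariant] AE_space
    proof eventually_elim
      case (elim \<omega>)
      note [measurable] = elim(2)
      interpret l: line_measure "\<xi> \<omega>" using line elim(2) .
      have "(\<integral>\<^sup>+u. f (\<theta> (- u) \<omega>) * mass_weight w (\<theta> (- u) \<omega>) u \<partial>lborel) =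
          (\<integral>\<^sup>+u. f (\<theta> (- (- u)) \<omega>) * mass_weight w (\<theta> (- (- u)) \<omega>) (- u) \<partial>lborel)"
        by (rule nn_integral_lborel_minus[symmetric]) measurable
      also have "\<dots> = (\<integral>\<^sup>+u. ennreal (inverse w) * (f (\<theta> u \<omega>) * indicator {0..S \<omega> w} u) \<partial>lborel)"
      proof (rule nn_integral_cong_AE)
        show "AE u in lborel. f (\<theta> (- (- u)) \<omega>) * mass_weight w (\<theta> (- (- u)) \<omega>) (- u) =
            ennreal (inverse w) * (f (\<theta> u \<omega>) * indicator {0..S \<omega> w} u)"
          using AE_lborel_neq[of 0]
        proof eventually_elim
          fix u :: real assume "u \<noteq> 0"
          \<comment> \<open>The weight describes the interval open at 0, since
            \<open>F \<omega> 0 = 0\<close> is excluded; the closed interval differs from it by the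
            null set \<open>{0}\<close>.\<close>
          then have "indicator {- w..<0} (- F \<omega> u) = (indicator {0..S \<omega> w} u :: ennreal)"
            using l.S_less_iff[of 0 u] l.le_S_iff[of u w] elim(1) by (auto simp: indicator_def)
          then show "f (\<theta> (- (- u)) \<omega>) * mass_weight w (\<theta> (- (- u)) \<omega>) (- u) =
            ennreal (inverse w) * (f (\<theta> u \<omega>) * indicator {0..S \<omega> w} u)"
            using elim(2) by (simp add: mass_weight_def F_shift mult_ac)
        qed
      qed
      also have "\<dots> = ennreal (inverse w) * (\<integral>\<^sup>+s\<in>{0..S \<omega> w}. f (\<theta> s \<omega>) \<partial>lborel)"
        by (rule nn_integral_cmult) measurable
      finally show ?case .
    qed
  qed
  also have "\<dots> = ennreal (inverse w) * (\<integral>\<^sup>+\<omega>. (\<integral>\<^sup>+s\<in>{0..S \<omega> w}. f (\<theta> s \<omega>) \<partial>lborel) \<partial>Q)"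
    by (rule nn_integral_cmult) measurable
  finally show ?thesis .
qed

end

subsection \<open>Reduction to an everywhere invariant kernel\<close>

lemma line_measure_lborel: "line_measure lborel"
proof
  have "(\<integral>\<^sup>+x. indicator {..<0::real} (- x) \<partial>lborel) = (\<integral>\<^sup>+x. indicator {..<0::real} x \<partial>lborel :: ennreal)"
    by (rule nn_integral_lborel_minus) measurable
  moreover have "indicator {..<0} (- x) = (indicator {0<..} x :: ennreal)" for x :: real
    by (simp add: indicator_def)
  ultimately have eq: "emeasure lborel {0::real<..} = emeasure lborel {..<0::real}"
    by simp
  have "emeasure lborel {0::real<..} = \<infinity>"
  proof (rule ccontr)
    assume "emeasure lborel {0::real<..} \<noteq> \<infinity>"
    then obtain c where c: "emeasure lborel {0::real<..} = ennreal c" "0 \<le> c"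
      by (cases "emeasure lborel {0::real<..}") auto
    have "emeasure lborel {0<..c + 1} \<le> emeasure lborel {0::real<..}"
      by (intro emeasure_mono) auto
    with c show False by simp
  qed
  then show "emeasure lborel {0::real<..} = \<infinity>" "emeasure lborel {..<0::real} = \<infinity>"
    by (simp_all only: eq)
qed (auto simp: emeasure_lborel_Icc_eq)

lemma emeasure_lborel_translate:
  assumes "B \<in> sets borel" shows "emeasure lborel (translate B t) = emeasure lborel B"
proof -
  have "(\<integral>\<^sup>+s. indicator B (s + t) \<partial>lborel) = (\<integral>\<^sup>+s. indicator B s \<partial>lborel :: ennreal)"
    using assms by (intro nn_integral_lborel_shift) auto
  then show ?thesis using assms by (simp add: indicator_translate[symmetric])
qed

lemma (in line_measure) emeasure_half_lines: "emeasure \<mu> {..<t} = \<infinity>" "emeasure \<mu> {t<..} = \<infinity>"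
proof -
  have fin: "emeasure \<mu> {a..b} \<noteq> \<infinity>" for a b using finite_Icc[of a b] by simp
  have "emeasure \<mu> {..<0} \<le> emeasure \<mu> ({..<t} \<union> {t..0})"
    by (intro emeasure_mono) auto
  also have "\<dots> \<le> emeasure \<mu> {..<t} + emeasure \<mu> {t..0}"
    by (intro emeasure_subadditive) auto
  finally show "emeasure \<mu> {..<t} = \<infinity>" using fin by (simp add: left_inf top_unique)
  have "emeasure \<mu> {0<..} \<le> emeasure \<mu> ({t<..} \<union> {0..t})"
    by (intro emeasure_mono) auto
  also have "\<dots> \<le> emeasure \<mu> {t<..} + emeasure \<mu> {0..t}"
    by (intro emeasure_subadditive) auto
  finally show "emeasure \<mu> {t<..} = \<infinity>" using fin by (simp add: right_inf top_unique)
qed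

text \<open>Dynkin's argument from rectangles; finiteness is needed for the complement, where masses
  are subtracted.\<close>

lemma emeasure_finite_kernel_Pair_measurable:
  assumes sets: "\<And>x. x \<in> space M \<Longrightarrow> sets (\<kappa> x) = sets N"
    and finite: "\<And>x. x \<in> space M \<Longrightarrow> emeasure (\<kappa> x) (space N) \<noteq> \<infinity>"
    and kernel: "\<And>B. B \<in> sets N \<Longrightarrow> (\<lambda>x. emeasure (\<kappa> x) B) \<in> borel_measurable M"
    and E: "E \<in> sets (M \<Otimes>\<^sub>M N)"
  shows "(\<lambda>x. emeasure (\<kappa> x) (Pair x -` E)) \<in> borel_measurable M"
  using Int_stable_pair_measure_generator pair_measure_closed E
  unfolding sets_pair_measure
proof (induct rule: sigma_sets_induct_disjoint)
  case (basic A)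
  then obtain a b where A: "A = a \<times> b" and [measurable]: "a \<in> sets M" and b: "b \<in> sets N" by auto
  have "emeasure (\<kappa> x) (Pair x -` A) = indicator a x * emeasure (\<kappa> x) b" for x
    by (simp add: A indicator_def)
  then show ?case using kernel[OF b] by simp
next
  case (compl A)
  have eq: "emeasure (\<kappa> x) (Pair x -` (space M \<times> space N - A)) =
      emeasure (\<kappa> x) (space N) - emeasure (\<kappa> x) (Pair x -` A)" if x: "x \<in> space M" for x
  proof -
    have A: "Pair x -` A \<in> sets (\<kappa> x)"
      using compl(1) by (simp add: sets[OF x] sets_Pair1 sets_pair_measure[symmetric])
    have sp: "space (\<kappa> x) = space N" using sets[OF x] by (rule sets_eq_imp_space_eq)
    have "emeasure (\<kappa> x) (Pair x -` A) \<noteq> \<infinity>"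
      using emeasure_space[of "\<kappa> x" "Pair x -` A"] finite[OF x] by (auto simp: sp top_unique)
    then show ?thesis
      using emeasure_compl[OF A] x by (simp add: vimage_Diff sp)
  qed
  then show ?case using compl(2) kernel[OF sets.top] by (subst measurable_cong[OF eq]) auto
next
  case (union F)
  have eq: "emeasure (\<kappa> x) (Pair x -` (\<Union>i. F i)) = (\<Sum>i. emeasure (\<kappa> x) (Pair x -` F i))"
    if x: "x \<in> space M" for x
    using union(1,2) sets[OF x]
    by (subst suminf_emeasure) (auto simp: vimage_UN disjoint_family_on_def sets_pair_measure[symmetric] intro!: sets_Pair1)
  then show ?case using union(3) by (subst measurable_cong[OF eq]) auto
qed simp

text \<open>A function that agrees almost everywhere with a measurable one is measurable for the
  completion, and its law is that of the measurable version.\<close>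

lemma distr_completion_cong_AE:
  assumes f: "f \<in> measurable M N" and ae: "AE x in M. g x = f x"
    and g: "\<And>x. x \<in> space M \<Longrightarrow> g x \<in> space N"
  shows "distr (completion M) N g = distr M N f"
proof -
  have "g \<in> measurable (completion M) N"
  proof (rule measurableI)
    fix A assume A: "A \<in> sets N"
    have "AE x in completion M. x \<in> f -` A \<inter> space M \<longleftrightarrow> x \<in> g -` A \<inter> space M"
      using AE_completion[OF ae] by eventually_elim auto
    moreover have "f -` A \<inter> space M \<in> sets (completion M)"
      using measurable_sets[OF f A] by (rule sets_completionI_sets)
    ultimately have "g -` A \<inter> space M \<in> sets (completion M)"
      by (rule completion.in_sets_AE) simp
    then show "g -` A \<inter> space (completion M) \<in> sets (completion M)"
      by simp
  qed (simp add: g)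
  then have "distr (completion M) N g = distr (completion M) N f"
    using AE_completion[OF ae] measurable_completion[OF f] by (intro distr_cong_AE refl)
  then show ?thesis using f by (simp add: distr_completion)
qed

section \<open>Flow-invariant sets on which the kernel is well-behaved\<close>

locale ae_flow_kernel = sigma_finite_measure Q + flow_on Q \<theta>
  for Q :: "'a measure" and \<xi> :: "'a \<Rightarrow> real measure" and \<theta> :: "real \<Rightarrow> 'a \<Rightarrow> 'a" +
  assumes rm: "random_measure Q \<xi>"
    and diffuse: "diffuse Q \<xi>"
    and invariant: "invariant_rm \<theta> Q \<xi>"
    and left_infinite: "emeasure Q {\<omega>\<in>space Q. emeasure (\<xi> \<omega>) {..<0} < \<infinity>} = 0"
    and right_infinite: "emeasure Q {\<omega>\<in>space Q. emeasure (\<xi> \<omega>) {0<..} < \<infinity>} = 0"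
begin

lemma sets_kernel: "\<omega> \<in> space Q \<Longrightarrow> sets (\<xi> \<omega>) = sets borel"
  using rm by (simp add: random_measure_def)

lemma kernel: "B \<in> sets borel \<Longrightarrow> (\<lambda>\<omega>. emeasure (\<xi> \<omega>) B) \<in> borel_measurable Q"
  using rm by (simp add: random_measure_def)

definition inv_set :: "'a set" where
  "inv_set = {\<omega> \<in> space Q. \<forall>t. \<forall>B\<in>sets borel.
     emeasure (\<xi> (\<theta> t \<omega>)) (translate B t) = emeasure (\<xi> \<omega>) B}"

text \<open>Local finiteness is tested on countably many intervals so that this set is measurable;
  it can therefore serve as a measurable restriction where \<open>good\<close> cannot.\<close>

definition lfin_set :: "'a set" where
  "lfin_set = {\<omega> \<in> space Q. \<forall>n::nat. emeasure (\<xi> \<omega>) {- real n..real n} < \<infinity>}"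

definition good :: "'a set" where
  "good = {\<omega> \<in> inv_set. line_measure (\<xi> \<omega>)}"

text \<open>Invariance at \<omega> covers all shifts at once, so both masses seen from
  \<open>\<theta> t \<omega>\<close> are compared with the same mass at \<omega>, using the shifts s
  + t and t.\<close>

lemma inv_set_flow:
  assumes \<omega>: "\<omega> \<in> inv_set" shows "\<theta> t \<omega> \<in> inv_set"
proof -
  have sp: "\<omega> \<in> space Q" and inv: "\<And>t B. B \<in> sets borel \<Longrightarrow>
      emeasure (\<xi> (\<theta> t \<omega>)) (translate B t) = emeasure (\<xi> \<omega>) B"
    using \<omega> by (auto simp: inv_set_def)
  have "emeasure (\<xi> (\<theta> s (\<theta> t \<omega>))) (translate B s) = emeasure (\<xi> (\<theta> t \<omega>)) B" if B: "B \<in> sets borel" for s B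
    using inv[OF translate_in_borel[OF B], of "s + t" "- t"] inv[OF translate_in_borel[OF B], of t "- t"] sp
    by (simp add: translate_translate)
  then show ?thesis using sp by (simp add: inv_set_def)
qed

lemma emeasure_flow:
  assumes "\<omega> \<in> inv_set" "B \<in> sets borel"
  shows "emeasure (\<xi> (\<theta> t \<omega>)) B = emeasure (\<xi> \<omega>) (translate B (- t))"
proof -
  have "emeasure (\<xi> (\<theta> t \<omega>)) (translate (translate B (- t)) t) = emeasure (\<xi> \<omega>) (translate B (- t))"
    using assms translate_in_borel[OF assms(2)] by (simp add: inv_set_def)
  then show ?thesis by (simp add: translate_translate)
qed

lemma emeasure_Icc_finite:
  assumes "\<omega> \<in> lfin_set" shows "emeasure (\<xi> \<omega>) {a..b} < \<infinity>"
proof -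
  obtain n :: nat where n: "max \<bar>a\<bar> \<bar>b\<bar> \<le> real n" using real_arch_simple by blast
  then have "{a..b} \<subseteq> {- real n..real n}" by auto
  then have "emeasure (\<xi> \<omega>) {a..b} \<le> emeasure (\<xi> \<omega>) {- real n..real n}"
    using assms sets_kernel by (intro emeasure_mono) (auto simp: lfin_set_def)
  then show ?thesis using assms by (auto simp: lfin_set_def intro: le_less_trans)
qed

lemma lfin_set_measurable [measurable]: "lfin_set \<in> sets Q"
proof -
  have [measurable]: "(\<lambda>\<omega>. emeasure (\<xi> \<omega>) {- real n..real n}) \<in> borel_measurable Q" for n
    by (rule kernel) simp
  show ?thesis unfolding lfin_set_def by measurable
qed

lemma translate_Icc: "translate {a..b} t = {a - t..b - t}"
  by (auto simp: translate_eq_vimage)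

lemma lfin_set_flow:
  assumes "\<omega> \<in> lfin_set" "\<omega> \<in> inv_set" shows "\<theta> t \<omega> \<in> lfin_set"
  using assms emeasure_Icc_finite[OF assms(1)]
  by (simp add: lfin_set_def emeasure_flow translate_Icc)

lemma good_subset_lfin_set: "good \<subseteq> lfin_set"
  using line_measure.finite_Icc by (auto simp: good_def inv_set_def lfin_set_def)

lemma good_flow:
  assumes "\<omega> \<in> good" shows "\<theta> t \<omega> \<in> good"
proof -
  interpret l: line_measure "\<xi> \<omega>" using assms by (simp add: good_def)
  have \<omega>: "\<omega> \<in> inv_set" and sp: "\<omega> \<in> space Q" using assms by (auto simp: good_def inv_set_def)
  have tr: "translate {x} (- t) = {x + t}" "translate {..<0} (- t) = {..<t}" "translate {0<..} (- t) = {t<..}" for x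
    by (auto simp: translate_eq_vimage)
  have "line_measure (\<xi> (\<theta> t \<omega>))"
    using sp sets_kernel l.finite_Icc
    by unfold_locales (auto simp: emeasure_flow[OF \<omega>] translate_Icc tr l.atomless l.emeasure_half_lines)
  then show ?thesis using inv_set_flow[OF \<omega>] by (simp add: good_def)
qed

lemma AE_good: "AE \<omega> in Q. \<omega> \<in> good"
proof -
  have [measurable]: "(\<lambda>\<omega>. emeasure (\<xi> \<omega>) {..<0}) \<in> borel_measurable Q"
    "(\<lambda>\<omega>. emeasure (\<xi> \<omega>) {0<..}) \<in> borel_measurable Q" by (auto intro: kernel)
  have "AE \<omega> in Q. \<not> emeasure (\<xi> \<omega>) {..<0} < \<infinity>"
    by (rule AE_I[OF _ left_infinite]) auto
  moreover have "AE \<omega> in Q. \<not> emeasure (\<xi> \<omega>) {0<..} < \<infinity>"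
    by (rule AE_I[OF _ right_infinite]) auto
  moreover have "AE \<omega> in Q. \<forall>C. compact C \<longrightarrow> emeasure (\<xi> \<omega>) C < \<infinity>"
    using rm by (simp add: random_measure_def)
  moreover have "AE \<omega> in Q. \<forall>x. emeasure (\<xi> \<omega>) {x} = 0"
    using diffuse by (simp add: diffuse_def)
  moreover have "AE \<omega> in Q. \<forall>t. \<forall>C\<in>sets borel. emeasure (\<xi> (\<theta> t \<omega>)) (translate C t) = emeasure (\<xi> \<omega>) C"
    using invariant by (simp add: invariant_rm_def)
  ultimately show ?thesis
    using AE_space
  proof eventually_elim
    case (elim \<omega>)
    have "line_measure (\<xi> \<omega>)"
      using elim sets_kernel by unfold_locales (auto simp: not_less top_unique)
    with elim show ?case by (simp add: good_def inv_set_def)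
  qed
qed

text \<open>
  The set \<open>good\<close> is invariant under the flow but need not be measurable; \<open>core\<close> is a
  measurable part of it of full \<open>Q\<close>-measure, and \<open>saturation\<close> is measurable and again
  invariant, being defined by the mass that \<open>\<xi>\<close> gives to visits of the core.
\<close>

definition core :: "'a set" where
  "core = (SOME A. A \<in> sets Q \<and> A \<subseteq> good \<and> (AE \<omega> in Q. \<omega> \<in> A))"

lemma core: "core \<in> sets Q \<and> core \<subseteq> good \<and> (AE \<omega> in Q. \<omega> \<in> core)"
  unfolding core_def
proof (rule someI_ex)
  obtain N where N: "{\<omega> \<in> space Q. \<omega> \<notin> good} \<subseteq> N" "emeasure Q N = 0" "N \<in> sets Q"
    by (rule AE_E[OF AE_good])
  have "AE \<omega> in Q. \<omega> \<in> space Q - N"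
    using AE_not_in[OF null_setsI[OF N(2,3)]] AE_space by eventually_elim auto
  then show "\<exists>A. A \<in> sets Q \<and> A \<subseteq> good \<and> (AE \<omega> in Q. \<omega> \<in> A)"
    using N by (intro exI[of _ "space Q - N"] conjI) (blast, blast, assumption)
qed

lemma core_measurable [measurable]: "core \<in> sets Q"
  and core_subset_good: "core \<subseteq> good"
  and AE_core: "AE \<omega> in Q. \<omega> \<in> core"
  using core by auto

definition saturation :: "'a set" where
  "saturation = {\<omega> \<in> lfin_set. emeasure (\<xi> \<omega>) {s. \<theta> s \<omega> \<in> core} \<noteq> 0}"

lemma orbit_in_borel [measurable]:
  assumes [measurable]: "\<omega> \<in> space Q" "A \<in> sets Q"
  shows "{s. \<theta> s \<omega> \<in> A} \<in> sets borel"
proof -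
  have "{s \<in> space borel. \<theta> s \<omega> \<in> A} \<in> sets borel" by measurable
  then show ?thesis by simp
qed

text \<open>Restricting to a bounded time interval and to \<open>lfin_set\<close> turns \<xi> into a
  finite kernel \<kappa>; the visits of A form the section at \<omega> of a measurable subset of the
  product.\<close>

lemma emeasure_orbit_measurable:
  assumes [measurable]: "A \<in> sets Q"
  shows "(\<lambda>\<omega>. indicator lfin_set \<omega> * emeasure (\<xi> \<omega>) {s \<in> {a..b}. \<theta> s \<omega> \<in> A}) \<in> borel_measurable Q"
proof -
  define \<kappa> where "\<kappa> \<omega> = (if \<omega> \<in> lfin_set then density (\<xi> \<omega>) (indicator {a..b}) else null_measure borel)" for \<omega>
  define E where "E = {x \<in> space (Q \<Otimes>\<^sub>M (borel :: real measure)). \<theta> (snd x) (fst x) \<in> A}"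
  have \<kappa>: "emeasure (\<kappa> \<omega>) B = indicator lfin_set \<omega> * emeasure (\<xi> \<omega>) ({a..b} \<inter> B)"
    if "\<omega> \<in> space Q" "B \<in> sets borel" for \<omega> B
  proof (cases "\<omega> \<in> lfin_set")
    case True
    have [measurable_cong]: "sets (\<xi> \<omega>) = sets borel" using sets_kernel that by simp
    have "emeasure (\<kappa> \<omega>) B = (\<integral>\<^sup>+s. indicator {a..b} s * indicator B s \<partial>\<xi> \<omega>)"
      using True that sets_kernel by (simp add: \<kappa>_def emeasure_density)
    also have "\<dots> = (\<integral>\<^sup>+s. indicator ({a..b} \<inter> B) s \<partial>\<xi> \<omega>)"
      by (intro nn_integral_cong) (simp add: indicator_inter_arith)
    also have "\<dots> = emeasure (\<xi> \<omega>) ({a..b} \<inter> B)"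
      using that sets_kernel by (intro nn_integral_indicator) auto
    finally show ?thesis using True by simp
  qed (simp add: \<kappa>_def)
  have E: "E \<in> sets (Q \<Otimes>\<^sub>M borel)"
    unfolding E_def by measurable
  have meas: "(\<lambda>\<omega>. emeasure (\<kappa> \<omega>) (Pair \<omega> -` E)) \<in> borel_measurable Q"
  proof (rule emeasure_finite_kernel_Pair_measurable[OF _ _ _ E])
    show "sets (\<kappa> \<omega>) = sets borel" if "\<omega> \<in> space Q" for \<omega>
      using that sets_kernel by (simp add: \<kappa>_def)
    show "emeasure (\<kappa> \<omega>) (space borel) \<noteq> \<infinity>" if "\<omega> \<in> space Q" for \<omega>
      using that emeasure_Icc_finite[of \<omega> a b] by (auto simp: \<kappa> indicator_def)
    show "(\<lambda>\<omega>. emeasure (\<kappa> \<omega>) B) \<in> borel_measurable Q" if "B \<in> sets borel" for B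
    proof -
      have [measurable]: "(\<lambda>\<omega>. emeasure (\<xi> \<omega>) ({a..b} \<inter> B)) \<in> borel_measurable Q"
        using that by (intro kernel) auto
      show ?thesis using that by (subst measurable_cong[OF \<kappa>]) auto
    qed
  qed
  have "emeasure (\<kappa> \<omega>) (Pair \<omega> -` E) =
      indicator lfin_set \<omega> * emeasure (\<xi> \<omega>) {s \<in> {a..b}. \<theta> s \<omega> \<in> A}" if \<omega>: "\<omega> \<in> space Q" for \<omega>
  proof -
    have "Pair \<omega> -` E = {s. \<theta> s \<omega> \<in> A}"
      using \<omega> by (auto simp: E_def space_pair_measure)
    moreover have "{a..b} \<inter> {s. \<theta> s \<omega> \<in> A} = {s \<in> {a..b}. \<theta> s \<omega> \<in> A}" by auto
    ultimately show ?thesis using \<omega> by (simp add: \<kappa> del: atLeastAtMost_iff)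
  qed
  from measurable_cong[THEN iffD1, OF this meas] show ?thesis .
qed

lemma saturation_measurable [measurable]: "saturation \<in> sets Q"
proof -
  let ?h = "\<lambda>n \<omega>. indicator lfin_set \<omega> * emeasure (\<xi> \<omega>) {s \<in> {- real n..real n}. \<theta> s \<omega> \<in> core}"
  have [measurable]: "?h n \<in> borel_measurable Q" for n
    by (rule emeasure_orbit_measurable) measurable
  have "saturation = {\<omega> \<in> space Q. \<exists>n. ?h n \<omega> \<noteq> 0}"
  proof (intro set_eqI iffI)
    fix \<omega> assume "\<omega> \<in> saturation"
    then have \<omega>: "\<omega> \<in> lfin_set" "emeasure (\<xi> \<omega>) {s. \<theta> s \<omega> \<in> core} \<noteq> 0" by (auto simp: saturation_def)
    have sp [measurable]: "\<omega> \<in> space Q" using \<omega> by (simp add: lfin_set_def)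
    have "\<exists>n. emeasure (\<xi> \<omega>) {s \<in> {- real n..real n}. \<theta> s \<omega> \<in> core} \<noteq> 0"
    proof (rule ccontr)
      assume "\<not> ?thesis"
      then have "emeasure (\<xi> \<omega>) (\<Union>n. {s \<in> {- real n..real n}. \<theta> s \<omega> \<in> core}) = 0"
        using sets_kernel[OF sp] by (intro emeasure_UN_eq_0) (auto simp: Collect_conj_eq)
      also have "(\<Union>n. {s \<in> {- real n..real n}. \<theta> s \<omega> \<in> core}) = {s. \<theta> s \<omega> \<in> core}"
      proof -
        have "\<exists>n::nat. - real n \<le> s \<and> s \<le> real n" for s
          using real_arch_simple[of "\<bar>s\<bar>"] by (auto simp: abs_le_iff minus_le_iff)
        then show ?thesis by auto
      qed
      finally show False using \<omega> by simp
    qed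
    then show "\<omega> \<in> {\<omega> \<in> space Q. \<exists>n. ?h n \<omega> \<noteq> 0}" using \<omega> sp by simp
  next
    fix \<omega> assume "\<omega> \<in> {\<omega> \<in> space Q. \<exists>n. ?h n \<omega> \<noteq> 0}"
    then obtain n where n: "?h n \<omega> \<noteq> 0" and sp [measurable]: "\<omega> \<in> space Q" by auto
    have "emeasure (\<xi> \<omega>) {s \<in> {- real n..real n}. \<theta> s \<omega> \<in> core} \<le> emeasure (\<xi> \<omega>) {s. \<theta> s \<omega> \<in> core}"
      using sets_kernel[OF sp] by (intro emeasure_mono) auto
    with n show "\<omega> \<in> saturation" by (auto simp: saturation_def indicator_def split: if_splits)
  qed
  moreover have "{\<omega> \<in> space Q. \<exists>n. ?h n \<omega> \<noteq> 0} \<in> sets Q" by measurable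
  ultimately show ?thesis by (simp only:)
qed

text \<open>A set of visits of nonzero mass contains at least one visit of \<open>core\<close>, and
  membership in \<open>good\<close> travels back along the orbit.\<close>

lemma saturation_subset_good: "saturation \<subseteq> good"
proof
  fix \<omega> assume "\<omega> \<in> saturation"
  then have sp: "\<omega> \<in> space Q" and "emeasure (\<xi> \<omega>) {s. \<theta> s \<omega> \<in> core} \<noteq> 0"
    by (auto simp: saturation_def lfin_set_def)
  then have "{s. \<theta> s \<omega> \<in> core} \<noteq> {}" by (metis emeasure_empty)
  then obtain s where "\<theta> s \<omega> \<in> good" using core_subset_good by auto
  from good_flow[OF this, of "- s"] show "\<omega> \<in> good" using sp by simp
qed

lemma saturation_flow:
  assumes "\<omega> \<in> saturation" shows "\<theta> t \<omega> \<in> saturation"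
proof -
  have \<omega>: "\<omega> \<in> good" "\<omega> \<in> inv_set" "\<omega> \<in> lfin_set" "\<omega> \<in> space Q"
    using assms saturation_subset_good by (auto simp: good_def inv_set_def saturation_def)
  have "{s. \<theta> s (\<theta> t \<omega>) \<in> core} = translate {s. \<theta> s \<omega> \<in> core} t"
    using \<omega> by (auto simp: translate_eq_vimage)
  moreover have "emeasure (\<xi> (\<theta> t \<omega>)) (translate {s. \<theta> s \<omega> \<in> core} t) = emeasure (\<xi> \<omega>) {s. \<theta> s \<omega> \<in> core}"
    using \<omega> by (simp add: inv_set_def orbit_in_borel)
  ultimately show ?thesis
    using assms lfin_set_flow[OF \<omega>(3,2)] by (simp add: saturation_def)
qed

lemma saturation_flow_iff: "\<omega> \<in> space Q \<Longrightarrow> \<theta> t \<omega> \<in> saturation \<longleftrightarrow> \<omega> \<in> saturation"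
  using saturation_flow[of "\<theta> t \<omega>" "- t"] saturation_flow[of \<omega> t] by auto

text \<open>The common target of the three conditions: each of them yields visits of
  \<open>core\<close> at \<xi>-almost every time.\<close>

lemma in_saturation_if_AE_orbit:
  assumes "\<omega> \<in> lfin_set" "emeasure (\<xi> \<omega>) UNIV \<noteq> 0" and ae: "AE s in \<xi> \<omega>. \<theta> s \<omega> \<in> core"
  shows "\<omega> \<in> saturation"
proof -
  have sp [measurable]: "\<omega> \<in> space Q" using assms by (simp add: lfin_set_def)
  have "emeasure (\<xi> \<omega>) {s. \<theta> s \<omega> \<in> core} = emeasure (\<xi> \<omega>) UNIV"
    using ae sets_kernel[OF sp] by (intro emeasure_eq_AE) auto
  then show ?thesis using assms by (simp add: saturation_def)
qed


section \<open>Replacement kernels\<close>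

lemma line_kernel_patch:
  assumes [measurable]: "A \<in> sets Q" and "A \<subseteq> good"
  shows "line_kernel Q (\<lambda>\<omega>. if \<omega> \<in> A then \<xi> \<omega> else lborel)"
proof (rule line_kernel.intro)
  show "line_measure (if \<omega> \<in> A then \<xi> \<omega> else lborel)" for \<omega>
    using assms(2) line_measure_lborel by (auto simp: good_def)
  fix B :: "real set" assume "B \<in> sets borel"
  note [measurable] = kernel[OF this]
  have "(\<lambda>\<omega>. if \<omega> \<in> A then emeasure (\<xi> \<omega>) B else emeasure lborel B) \<in> borel_measurable Q"
    by measurable
  also have "(\<lambda>\<omega>. if \<omega> \<in> A then emeasure (\<xi> \<omega>) B else emeasure lborel B) =
      (\<lambda>\<omega>. emeasure (if \<omega> \<in> A then \<xi> \<omega> else lborel) B)"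
    by (rule ext) simp
  finally show "(\<lambda>\<omega>. emeasure (if \<omega> \<in> A then \<xi> \<omega> else lborel) B) \<in> borel_measurable Q" .
qed

text \<open>A version of \<xi> that is regular on every path and agrees with \<xi> almost everywhere
  before \<open>saturation\<close> is known to have full measure. It need not be invariant under the
  flow.\<close>

definition core_kernel :: "'a \<Rightarrow> real measure" where
  "core_kernel \<omega> = (if \<omega> \<in> core then \<xi> \<omega> else lborel)"

text \<open>Invariant on every path, since \<open>saturation\<close> is flow-invariant and Lebesgue
  measure is invariant under translations.\<close>

definition regular_kernel :: "'a \<Rightarrow> real measure" where
  "regular_kernel \<omega> = (if \<omega> \<in> saturation then \<xi> \<omega> else lborel)"

sublocale core: line_kernel Q core_kernel
  unfolding core_kernel_def[abs_def] by (rule line_kernel_patch[OF core_measurable core_subset_good])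

sublocale regular: measured_flow_kernel Q regular_kernel \<theta>
proof -
  interpret line_kernel Q regular_kernel
    unfolding regular_kernel_def[abs_def] by (rule line_kernel_patch[OF saturation_measurable saturation_subset_good])
  show "measured_flow_kernel Q regular_kernel \<theta>"
  proof
    fix \<omega> t and B :: "real set" assume "\<omega> \<in> space Q" "B \<in> sets borel"
    then show "emeasure (regular_kernel (\<theta> t \<omega>)) (translate B t) = emeasure (regular_kernel \<omega>) B"
      using saturation_subset_good
      by (auto simp: regular_kernel_def saturation_flow_iff emeasure_lborel_translate good_def inv_set_def)
  qed
qed

section \<open>Each of the three conditions puts Q on the saturation\<close>

lemma shifted_law_eq:
  assumes "line_kernel Q \<kappa>" and ae: "AE \<omega> in Q. \<kappa> \<omega> = \<xi> \<omega>"
  shows "shifted_law \<theta> Q (gen_inverse \<xi> r) = distr Q Q (\<lambda>\<omega>. \<theta> (mass_inv (\<kappa> \<omega>) r) \<omega>)"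
proof -
  interpret k: line_kernel Q \<kappa> by fact
  show ?thesis
    unfolding shifted_law_def
  proof (rule distr_completion_cong_AE)
    show "(\<lambda>\<omega>. \<theta> (mass_inv (\<kappa> \<omega>) r) \<omega>) \<in> measurable Q Q"
      by (intro flow_measurable k.S_measurable) (simp_all add: measurable_ident_sets)
    show "AE \<omega> in Q. \<theta> (gen_inverse \<xi> r \<omega>) \<omega> = \<theta> (mass_inv (\<kappa> \<omega>) r) \<omega>"
      using ae by eventually_elim (simp add: gen_inverse_eq_mass_inv[of \<xi>])
  qed simp
qed

text \<open>For each fixed r the shifted point has law Q and so lies in \<open>core\<close> almost
  surely. Fubini exchanges the quantifiers, and Lebesgue-almost every level r becomes \<xi>-almost
  every time s.\<close>

lemma AE_saturation_if_shift_invariant: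
  assumes A: "\<And>r. shifted_law \<theta> Q (gen_inverse \<xi> r) = Q"
  shows "AE \<omega> in Q. \<omega> \<in> saturation"
proof -
  let ?T = "\<lambda>r \<omega>. \<theta> (mass_inv (core_kernel \<omega>) r) \<omega>"
  have "AE \<omega> in Q. core_kernel \<omega> = \<xi> \<omega>"
    using AE_core by eventually_elim (simp add: core_kernel_def)
  then have distr: "distr Q Q (?T r) = Q" for r
    using shifted_law_eq[OF core.line_kernel_axioms, of r] A by simp
  have "AE \<omega> in Q. ?T r \<omega> \<in> core" for r
  proof -
    have "AE \<omega> in distr Q Q (?T r). \<omega> \<in> core" unfolding distr by (rule AE_core)
    then show ?thesis by (subst (asm) AE_distr_iff) auto
  qed
  then have "AE r in lborel. AE \<omega> in Q. ?T r \<omega> \<in> core" by simp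
  moreover have "{x \<in> space (Q \<Otimes>\<^sub>M lborel). ?T (snd x) (fst x) \<in> core} \<in> sets (Q \<Otimes>\<^sub>M lborel)"
    by measurable
  ultimately have "AE \<omega> in Q. AE r in lborel. ?T r \<omega> \<in> core"
    using regular.QL.AE_commute[of "\<lambda>\<omega> r. ?T r \<omega> \<in> core"] by blast
  then show ?thesis
    using AE_core
  proof eventually_elim
    case (elim \<omega>)
    then have \<omega>: "\<omega> \<in> good" "\<omega> \<in> lfin_set" and sp [measurable]: "\<omega> \<in> space Q"
      using core_subset_good good_subset_lfin_set by (auto simp: lfin_set_def)
    interpret l: line_measure "\<xi> \<omega>" using \<omega> by (simp add: good_def)
    have "AE s in distr lborel borel l.S. \<theta> s \<omega> \<in> core"
      using elim by (subst AE_distr_iff) (auto simp: core_kernel_def)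
    then have "AE s in \<xi> \<omega>. \<theta> s \<omega> \<in> core" by (simp only: l.distr_S)
    with \<omega> l.emeasure_UNIV show ?case by (intro in_saturation_if_AE_orbit) auto
  qed
qed

text \<open>Tested on the indicator of the complement of \<open>core\<close>, the right-hand side
  vanishes; hence so does the left-hand side, which samples the path at \<xi>-typical times of a
  window. Countably many windows exhaust the line.\<close>

lemma AE_saturation_if_mass_stationary:
  assumes B: "mass_stationary \<theta> Q \<xi>"
  shows "AE \<omega> in Q. \<omega> \<in> saturation"
proof -
  define f where "f = (\<lambda>(\<omega>, u::real). indicator (space Q - core) \<omega> :: real)"
  have f [measurable]: "f \<in> borel_measurable (Q \<Otimes>\<^sub>M borel)" unfolding f_def by measurable
  have window: "AE \<omega> in Q. \<omega> \<in> core \<longrightarrow> (AE s in \<xi> \<omega>. s \<in> {- N..N - 1} \<longrightarrow> \<theta> s \<omega> \<in> core)"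
    if N: "N \<ge> 1" for N :: real
  proof -
    \<comment> \<open>The mass of the moving window is written as an integral against
      \<open>core_kernel\<close>, which provides joint measurability in \<omega> and u.\<close>
    define m where "m \<omega> u = (\<integral>\<^sup>+s. indicator {-N..N} (s + u) \<partial>core_kernel \<omega>)" for \<omega> u
    define g where "g \<omega> u s = indicator {-N..N} u * (indicator {-N..N} (s + u) / m \<omega> u) * ennreal (f (\<theta> s \<omega>, s + u))"
      for \<omega> u s
    have [measurable (raw)]: "(\<lambda>x. m (h x) (a x)) \<in> borel_measurable K"
      if "h \<in> measurable K Q" "a \<in> borel_measurable K" for h a and K :: "'c measure"
      using that unfolding m_def by measurable
    have m_eq: "m \<omega> u = emeasure (\<xi> \<omega>) (translate {-N..N} u)" if "\<omega> \<in> core" for \<omega> u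
    proof -
      have "m \<omega> u = (\<integral>\<^sup>+s. indicator (translate {-N..N} u) s \<partial>\<xi> \<omega>)"
        using that by (simp add: m_def core_kernel_def indicator_translate)
      also have "\<dots> = emeasure (\<xi> \<omega>) (translate {-N..N} u)"
        using that core_subset_good sets_kernel[of \<omega>] by (intro nn_integral_indicator) (auto simp: good_def inv_set_def)
      finally show ?thesis .
    qed
    have "(\<integral>\<^sup>+\<omega>. \<integral>\<^sup>+u. \<integral>\<^sup>+s. g \<omega> u s \<partial>core_kernel \<omega> \<partial>lborel \<partial>Q) =
        (\<integral>\<^sup>+\<omega>. \<integral>\<^sup>+u. \<integral>\<^sup>+s. indicator {-N..N} u * (indicator (translate {-N..N} u) s /
          emeasure (\<xi> \<omega>) (translate {-N..N} u)) * ennreal (f (\<theta> s \<omega>, s + u)) \<partial>\<xi> \<omega> \<partial>lborel \<partial>Q)"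
    proof (rule nn_integral_cong_AE)
      show "AE \<omega> in Q. (\<integral>\<^sup>+u. \<integral>\<^sup>+s. g \<omega> u s \<partial>core_kernel \<omega> \<partial>lborel) =
          (\<integral>\<^sup>+u. \<integral>\<^sup>+s. indicator {-N..N} u * (indicator (translate {-N..N} u) s /
          emeasure (\<xi> \<omega>) (translate {-N..N} u)) * ennreal (f (\<theta> s \<omega>, s + u)) \<partial>\<xi> \<omega> \<partial>lborel)"
        using AE_core by eventually_elim (simp add: g_def m_eq core_kernel_def indicator_translate)
    qed
    also have "\<dots> = (\<integral>\<^sup>+\<omega>. \<integral>\<^sup>+u. indicator {-N..N} u * ennreal (f (\<theta> 0 \<omega>, u)) \<partial>lborel \<partial>Q)"
      using N by (intro B[unfolded mass_stationary_def, rule_format])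
        (auto simp: emeasure_frontier_Icc f_def)
    also have "\<dots> = (\<integral>\<^sup>+\<omega>. 0 \<partial>Q)"
      using AE_core by (intro nn_integral_cong_AE, eventually_elim)
        (use core_subset_good in \<open>auto simp: f_def good_def inv_set_def\<close>)
    finally have "(\<integral>\<^sup>+\<omega>. \<integral>\<^sup>+u. \<integral>\<^sup>+s. g \<omega> u s \<partial>core_kernel \<omega> \<partial>lborel \<partial>Q) = 0" by simp
    then have "AE \<omega> in Q. (\<integral>\<^sup>+u. \<integral>\<^sup>+s. g \<omega> u s \<partial>core_kernel \<omega> \<partial>lborel) = 0"
      unfolding g_def by (subst (asm) nn_integral_0_iff_AE) measurable
    then show ?thesis
    proof (eventually_elim, intro impI)
      fix \<omega> assume zero: "(\<integral>\<^sup>+u. \<integral>\<^sup>+s. g \<omega> u s \<partial>core_kernel \<omega> \<partial>lborel) = 0" and core: "\<omega> \<in> core"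
      have \<omega>: "\<omega> \<in> good" "\<omega> \<in> lfin_set" and sp [measurable]: "\<omega> \<in> space Q"
        using core core_subset_good good_subset_lfin_set by (auto simp: lfin_set_def)
      interpret l: line_measure "\<xi> \<omega>" using \<omega> by (simp add: good_def)
      have ae: "AE u in lborel. (\<integral>\<^sup>+s. g \<omega> u s \<partial>core_kernel \<omega>) = 0"
        using zero unfolding g_def by (subst (asm) nn_integral_0_iff_AE) measurable
      \<comment> \<open>One exceptional-free u is enough: for u in \<open>{0..1}\<close> the window
        \<open>{- N - u..N - u}\<close> contains \<open>{- N..N - 1}\<close>.\<close>
      have "\<exists>u\<in>{0..1}. (\<integral>\<^sup>+s. g \<omega> u s \<partial>core_kernel \<omega>) = 0"
      proof (rule ccontr)
        assume "\<not> ?thesis"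
        with ae have "AE u in lborel. \<not> u \<in> {0..1::real}" by (auto elim: eventually_mono)
        from emeasure_eq_0_AE[OF this] have "emeasure lborel {0..1::real} = 0" by (simp del: atLeastAtMost_iff emeasure_lborel_Icc)
        then show False by simp
      qed
      then obtain u where u: "u \<in> {0..1}" "(\<integral>\<^sup>+s. g \<omega> u s \<partial>\<xi> \<omega>) = 0"
        using core by (auto simp: core_kernel_def)
      then have "AE s in \<xi> \<omega>. g \<omega> u s = 0"
        unfolding g_def by (subst (asm) nn_integral_0_iff_AE) auto
      then show "AE s in \<xi> \<omega>. s \<in> {- N..N - 1} \<longrightarrow> \<theta> s \<omega> \<in> core"
      proof (rule eventually_mono, intro impI)
        fix s assume s: "g \<omega> u s = 0" "s \<in> {- N..N - 1}"
        \<comment> \<open>Finiteness keeps the quotient by \<open>m \<omega> u\<close> nonzero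
          (division by 0 would give \<infinity>), so the vanishing of \<open>g\<close> is due to
          \<open>f\<close>.\<close>
        have "m \<omega> u \<noteq> top"
          using emeasure_Icc_finite[OF \<omega>(2), of "- N - u" "N - u"] by (simp add: m_eq[OF core] translate_Icc)
        then have "f (\<theta> s \<omega>, s + u) \<le> 0"
          using s u(1) N by (auto simp: g_def ennreal_eq_0_iff divide_ennreal_def)
        then show "\<theta> s \<omega> \<in> core" using sp by (cases "\<theta> s \<omega> \<in> core") (auto simp: f_def)
      qed
    qed
  qed
  have "AE \<omega> in Q. \<forall>n. \<omega> \<in> core \<longrightarrow> (AE s in \<xi> \<omega>. s \<in> {- real (Suc n)..real (Suc n) - 1} \<longrightarrow> \<theta> s \<omega> \<in> core)"
    unfolding AE_all_countable by (intro allI window) simp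
  then show ?thesis
    using AE_core
  proof eventually_elim
    case (elim \<omega>)
    then have \<omega>: "\<omega> \<in> good" "\<omega> \<in> lfin_set"
      using core_subset_good good_subset_lfin_set by auto
    interpret l: line_measure "\<xi> \<omega>" using \<omega> by (simp add: good_def)
    have "AE s in \<xi> \<omega>. \<forall>n. s \<in> {- real (Suc n)..real (Suc n) - 1} \<longrightarrow> \<theta> s \<omega> \<in> core"
      unfolding AE_all_countable using elim by blast
    then have "AE s in \<xi> \<omega>. \<theta> s \<omega> \<in> core"
    proof (rule eventually_mono)
      fix s assume s: "\<forall>n. s \<in> {- real (Suc n)..real (Suc n) - 1} \<longrightarrow> \<theta> s \<omega> \<in> core"
      obtain n :: nat where "\<bar>s\<bar> \<le> real n" using real_arch_simple by blast
      then have "s \<in> {- real (Suc n)..real (Suc n) - 1}" by auto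
      with s show "\<theta> s \<omega> \<in> core" by blast
    qed
    with \<omega> l.emeasure_UNIV show ?case by (intro in_saturation_if_AE_orbit) auto
  qed
qed


lemma AE_regular_kernel:
  assumes "AE \<omega> in P. \<omega> \<in> saturation"
  shows "AE \<omega> in P. regular_kernel \<omega> = \<xi> \<omega>"
  using assms by eventually_elim (simp add: regular_kernel_def)

lemma line_measure_if_saturation: "\<omega> \<in> saturation \<Longrightarrow> line_measure (\<xi> \<omega>)"
  using saturation_subset_good by (auto simp: good_def)

context
  fixes P :: "'a measure"
  assumes palm: "palm_of_stationary \<theta> \<xi> Q P"
begin

lemma sets_palm [measurable_cong]: "sets P = sets Q"
  using palm by (simp add: palm_of_stationary_def is_palm_measure_def)

lemma space_palm: "space P = space Q"
  using sets_palm by (rule sets_eq_imp_space_eq)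

lemma nn_integral_flow_palm:
  assumes "f \<in> borel_measurable Q"
  shows "(\<integral>\<^sup>+\<eta>. f (\<theta> t \<eta>) \<partial>P) = (\<integral>\<^sup>+\<eta>. f \<eta> \<partial>P)"
proof -
  have [measurable]: "\<theta> t \<in> measurable P P" by measurable
  have "f \<in> borel_measurable P" using assms by (simp cong: measurable_cong_sets add: sets_palm)
  then have "(\<integral>\<^sup>+\<eta>. f \<eta> \<partial>distr P P (\<theta> t)) = (\<integral>\<^sup>+\<eta>. f (\<theta> t \<eta>) \<partial>P)"
    by (intro nn_integral_distr) auto
  moreover have "distr P P (\<theta> t) = P"
    using palm by (simp add: palm_of_stationary_def stationary_def)
  ultimately show ?thesis by simp
qed

lemma emeasure_palm:
  assumes "A \<in> sets Q"
  shows "emeasure Q A = (\<integral>\<^sup>+\<omega>. \<integral>\<^sup>+s. indicator {0..1} s * indicator A (\<theta> s \<omega>) \<partial>\<xi> \<omega> \<partial>P)"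
  using palm assms sets_palm by (simp add: palm_of_stationary_def is_palm_measure_def)

lemma AE_palm_lfin_inv: "AE \<omega> in P. \<omega> \<in> lfin_set \<and> \<omega> \<in> inv_set"
proof -
  have "AE \<omega> in P. \<forall>C. compact C \<longrightarrow> emeasure (\<xi> \<omega>) C < \<infinity>"
    using palm by (simp add: palm_of_stationary_def random_measure_def)
  moreover have "AE \<omega> in P. \<forall>t. \<forall>C\<in>sets borel. emeasure (\<xi> (\<theta> t \<omega>)) (translate C t) = emeasure (\<xi> \<omega>) C"
    using palm by (simp add: palm_of_stationary_def invariant_rm_def)
  ultimately show ?thesis
    using AE_space by eventually_elim (simp add: lfin_set_def inv_set_def space_palm)
qed

text \<open>The complement of \<open>core\<close> is Q-null, so by the Palm formula P-almost every
  path visits it at \<xi>-almost no time in the unit interval; stationarity extends this to the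
  whole line. Paths without mass remain as the second alternative.\<close>

lemma AE_palm_saturation_or_null: "AE \<omega> in P. \<omega> \<in> saturation \<or> emeasure (\<xi> \<omega>) UNIV = 0"
proof -
  define N where "N = space Q - core"
  have N [measurable]: "N \<in> sets Q" unfolding N_def by measurable
  \<comment> \<open>The factor \<open>indicator lfin_set\<close> makes this function measurable and
    is 1 for P-almost every \<omega>.\<close>
  define h where "h \<omega> = indicator lfin_set \<omega> * emeasure (\<xi> \<omega>) {s \<in> {0..1}. \<theta> s \<omega> \<in> N}" for \<omega>
  have h [measurable]: "h \<in> borel_measurable Q"
    unfolding h_def by (rule emeasure_orbit_measurable[OF N])
  have "(\<integral>\<^sup>+\<omega>. h \<omega> \<partial>P) = (\<integral>\<^sup>+\<omega>. \<integral>\<^sup>+s. indicator {0..1} s * indicator N (\<theta> s \<omega>) \<partial>\<xi> \<omega> \<partial>P)"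
  proof (rule nn_integral_cong_AE)
    show "AE \<omega> in P. h \<omega> = (\<integral>\<^sup>+s. indicator {0..1} s * indicator N (\<theta> s \<omega>) \<partial>\<xi> \<omega>)"
      using AE_palm_lfin_inv
    proof eventually_elim
      case (elim \<omega>)
      then have sp [measurable]: "\<omega> \<in> space Q" by (simp add: lfin_set_def)
      have "(\<integral>\<^sup>+s. indicator {0..1} s * indicator N (\<theta> s \<omega>) \<partial>\<xi> \<omega>) =
          (\<integral>\<^sup>+s. indicator {s \<in> {0..1}. \<theta> s \<omega> \<in> N} s \<partial>\<xi> \<omega>)"
        by (intro nn_integral_cong) (simp add: indicator_def)
      also have "\<dots> = emeasure (\<xi> \<omega>) {s \<in> {0..1}. \<theta> s \<omega> \<in> N}"
        using orbit_in_borel[OF sp N] sets_kernel[OF sp]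
        by (intro nn_integral_indicator) (simp add: Collect_conj_eq)
      finally show ?case using elim by (simp add: h_def)
    qed
  qed
  also have "\<dots> = emeasure Q N" by (rule emeasure_palm[symmetric]) measurable
  also have "\<dots> = 0"
    using AE_core by (subst AE_iff_measurable[OF N, symmetric, of "\<lambda>\<omega>. \<omega> \<in> core"]) (auto simp: N_def)
  finally have h0: "(\<integral>\<^sup>+\<omega>. h \<omega> \<partial>P) = 0" .
  have "AE \<omega> in P. h (\<theta> t \<omega>) = 0" for t
  proof -
    have "(\<integral>\<^sup>+\<omega>. h (\<theta> t \<omega>) \<partial>P) = 0" using nn_integral_flow_palm[OF h] h0 by simp
    then show ?thesis by (subst (asm) nn_integral_0_iff_AE) measurable
  qed
  \<comment> \<open>Integer shifts keep the union of exceptional sets countable, and the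
    corresponding unit intervals cover the line.\<close>
  then have "AE \<omega> in P. \<forall>k::int. h (\<theta> (real_of_int k) \<omega>) = 0"
    unfolding AE_all_countable by blast
  then show ?thesis
    using AE_palm_lfin_inv
  proof eventually_elim
    case (elim \<omega>)
    then have sp [measurable]: "\<omega> \<in> space Q" by (simp add: lfin_set_def)
    have "emeasure (\<xi> \<omega>) {s \<in> {real_of_int k..real_of_int k + 1}. \<theta> s \<omega> \<in> N} = 0" for k
    proof -
      have "{s \<in> {real_of_int k..real_of_int k + 1}. \<theta> s \<omega> \<in> N} =
          translate {s \<in> {0..1}. \<theta> s (\<theta> (real_of_int k) \<omega>) \<in> N} (- real_of_int k)"
        using sp by (auto simp: translate_eq_vimage)
      also have "emeasure (\<xi> \<omega>) \<dots> = emeasure (\<xi> (\<theta> (real_of_int k) \<omega>)) {s \<in> {0..1}. \<theta> s (\<theta> (real_of_int k) \<omega>) \<in> N}"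
        using elim sp orbit_in_borel[of "\<theta> (real_of_int k) \<omega>" N]
        by (intro emeasure_flow[symmetric]) (simp_all add: Collect_conj_eq)
      also have "\<dots> = 0"
        using elim(1)[rule_format, of k] elim(2) lfin_set_flow by (simp add: h_def)
      finally show ?thesis .
    qed
    then have "emeasure (\<xi> \<omega>) {s \<in> {real_of_int (from_nat n)..real_of_int (from_nat n) + 1}. \<theta> s \<omega> \<in> N} = 0" for n
      by blast
    then have "emeasure (\<xi> \<omega>) (\<Union>n. {s \<in> {real_of_int (from_nat n)..real_of_int (from_nat n) + 1}. \<theta> s \<omega> \<in> N}) = 0"
      using sets_kernel[OF sp] orbit_in_borel[OF sp N] by (intro emeasure_UN_eq_0) (auto simp: Collect_conj_eq)
    also have "(\<Union>n. {s \<in> {real_of_int (from_nat n)..real_of_int (from_nat n) + 1}. \<theta> s \<omega> \<in> N}) = {s. \<theta> s \<omega> \<in> N}"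
    proof -
      have "\<exists>n. real_of_int (from_nat n) \<le> s \<and> s \<le> real_of_int (from_nat n) + 1" for s
        by (rule exI[of _ "to_nat \<lfloor>s\<rfloor>"]) (simp add: less_imp_le)
      then show ?thesis by auto
    qed
    finally have "emeasure (\<xi> \<omega>) {s. \<theta> s \<omega> \<in> N} = 0" .
    then have "AE s in \<xi> \<omega>. \<theta> s \<omega> \<in> core"
      using orbit_in_borel[OF sp N] sets_kernel[OF sp] sp
      by (subst AE_iff_measurable[of "{s. \<theta> s \<omega> \<in> N}"]) (auto simp: N_def dest: sets_eq_imp_space_eq)
    then show ?case using in_saturation_if_AE_orbit elim by blast
  qed
qed

text \<open>The Palm formula sees a path only through its \<xi>-mass: orbits of saturated points
  stay saturated, and paths without mass contribute nothing.\<close>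

lemma AE_saturation_if_palm: "AE \<omega> in Q. \<omega> \<in> saturation"
proof -
  have "emeasure Q (space Q - saturation) =
      (\<integral>\<^sup>+\<omega>. \<integral>\<^sup>+s. indicator {0..1} s * indicator (space Q - saturation) (\<theta> s \<omega>) \<partial>\<xi> \<omega> \<partial>P)"
    by (rule emeasure_palm) measurable
  also have "\<dots> = (\<integral>\<^sup>+\<omega>. 0 \<partial>P)"
  proof (rule nn_integral_cong_AE)
    show "AE \<omega> in P. (\<integral>\<^sup>+s. indicator {0..1} s * indicator (space Q - saturation) (\<theta> s \<omega>) \<partial>\<xi> \<omega>) = 0"
      using AE_palm_saturation_or_null AE_space
    proof eventually_elim
      case (elim \<omega>)
      then have sp: "\<omega> \<in> space Q" by (simp add: space_palm)
      from elim(1) show ?case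
      proof
        assume "\<omega> \<in> saturation"
        then show ?thesis using saturation_flow by simp
      next
        assume null: "emeasure (\<xi> \<omega>) UNIV = 0"
        have "AE s in \<xi> \<omega>. indicator {0..1} s * indicator (space Q - saturation) (\<theta> s \<omega>) = (0 :: ennreal)"
          by (rule AE_I[OF _ null]) (simp_all add: sets_kernel[OF sp])
        then show ?thesis by (subst nn_integral_cong_AE[of _ "\<lambda>_. 0"]) auto
      qed
    qed
  qed
  finally have "emeasure Q (space Q - saturation) = 0" by simp
  then show ?thesis
    by (subst AE_iff_measurable[of "space Q - saturation"]) auto
qed

end


section \<open>Transfer from the regular kernel back to the given one\<close>

lemma shift_invariant_iff_regular:
  assumes "AE \<omega> in Q. \<omega> \<in> saturation"
  shows "(\<forall>r. shifted_law \<theta> Q (gen_inverse \<xi> r) = Q) \<longleftrightarrow> regular.mass_shift_invariant"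
  using shifted_law_eq[OF regular.line_kernel_axioms AE_regular_kernel[OF assms]]
  by (simp add: regular.mass_shift_invariant_def)

lemma mass_stationary_iff_regular:
  assumes "AE \<omega> in Q. \<omega> \<in> saturation"
  shows "mass_stationary \<theta> Q \<xi> \<longleftrightarrow> mass_stationary \<theta> Q regular_kernel"
proof -
  have "(\<integral>\<^sup>+\<omega>. (\<integral>\<^sup>+u. (\<integral>\<^sup>+s.
          indicator C u * (indicator (translate C u) s / emeasure (\<xi> \<omega>) (translate C u))
            * ennreal (f (\<theta> s \<omega>, s + u)) \<partial>\<xi> \<omega>) \<partial>lborel) \<partial>Q) =
        (\<integral>\<^sup>+\<omega>. (\<integral>\<^sup>+u. (\<integral>\<^sup>+s.
          indicator C u * (indicator (translate C u) s / emeasure (regular_kernel \<omega>) (translate C u))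
            * ennreal (f (\<theta> s \<omega>, s + u)) \<partial>regular_kernel \<omega>) \<partial>lborel) \<partial>Q)" for C and f :: "'a \<times> real \<Rightarrow> real"
    using AE_regular_kernel[OF assms] by (intro nn_integral_cong_AE, eventually_elim) simp
  then show ?thesis by (simp add: mass_stationary_def)
qed

lemma is_palm_measure_iff_regular:
  assumes "AE \<omega> in P. \<omega> \<in> saturation"
  shows "is_palm_measure \<theta> P \<xi> Q \<longleftrightarrow> is_palm_measure \<theta> P regular_kernel Q"
proof -
  have "(\<integral>\<^sup>+\<omega>. (\<integral>\<^sup>+s. indicator {0..1} s * indicator A (\<theta> s \<omega>) \<partial>\<xi> \<omega>) \<partial>P) =
      (\<integral>\<^sup>+\<omega>. (\<integral>\<^sup>+s. indicator {0..1} s * indicator A (\<theta> s \<omega>) \<partial>regular_kernel \<omega>) \<partial>P)" for A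
    using AE_regular_kernel[OF assms] by (intro nn_integral_cong_AE, eventually_elim) simp
  then show ?thesis by (simp add: is_palm_measure_def)
qed

lemma AE_palm_saturation:
  assumes "palm_of_stationary \<theta> \<xi> Q P" "no_mass_on_zero \<xi> P"
  shows "AE \<omega> in P. \<omega> \<in> saturation"
proof -
  note sp = space_palm[OF assms(1)]
  have [measurable]: "(\<lambda>\<omega>. emeasure (\<xi> \<omega>) UNIV) \<in> borel_measurable Q" by (rule kernel) simp
  have "{\<omega> \<in> space Q. emeasure (\<xi> \<omega>) UNIV = 0} \<in> sets Q" by measurable
  then have "AE \<omega> in P. emeasure (\<xi> \<omega>) UNIV \<noteq> 0"
    using assms(2) unfolding no_mass_on_zero_def by (intro AE_I) (auto simp: sp sets_palm[OF assms(1)])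
  with AE_palm_saturation_or_null[OF assms(1)] show ?thesis
    by eventually_elim auto
qed

lemma palm_pair_if_palm:
  assumes "palm_of_stationary \<theta> \<xi> Q P" "AE \<omega> in P. \<omega> \<in> saturation"
  shows "palm_pair Q P regular_kernel \<theta>"
  using assms is_palm_measure_iff_regular[OF assms(2)]
  by (intro palm_pair.intro regular.measured_flow_kernel_axioms palm_pair_axioms.intro)
    (auto simp: palm_of_stationary_def)

text \<open>P is replaced by its restriction \<open>P'\<close> to \<open>saturation\<close>. The
  discarded part consists of paths without mass and does not enter the Palm measure of \<xi>, though
  \<open>regular_kernel\<close> would give it mass. Stationarity survives because
  \<open>saturation\<close> is flow-invariant.\<close>

lemma shift_invariant_if_palm:
  assumes palm: "palm_of_stationary \<theta> \<xi> Q P"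
  shows "shifted_law \<theta> Q (gen_inverse \<xi> r) = Q"
proof -
  note [measurable_cong] = sets_palm[OF palm]
  note sp = space_palm[OF palm]
  define P' where "P' = density P (indicator saturation)"
  have [measurable]: "(indicator saturation :: 'a \<Rightarrow> ennreal) \<in> borel_measurable P"
    by (rule borel_measurable_indicator) (simp add: sets_palm[OF palm])
  have sets' [measurable_cong]: "sets P' = sets Q" by (simp add: P'_def sets_palm[OF palm])
  have sp': "space P' = space Q" using sets' by (rule sets_eq_imp_space_eq)
  have nn_P': "(\<integral>\<^sup>+\<omega>. f \<omega> \<partial>P') = (\<integral>\<^sup>+\<omega>. indicator saturation \<omega> * f \<omega> \<partial>P)"
    if "f \<in> borel_measurable Q" for f
    using that unfolding P'_def by (intro nn_integral_density) (simp_all cong: measurable_cong_sets add: sets_palm[OF palm])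
  interpret P: sigma_finite_measure P using palm by (simp add: palm_of_stationary_def)
  have "sigma_finite_measure P'"
    unfolding P'_def by (subst P.sigma_finite_iff_density_finite) (auto simp: indicator_def)
  moreover have "stationary \<theta> P'"
    unfolding stationary_def
  proof (intro allI measure_eqI)
    fix t A assume "A \<in> sets (distr P' P' (\<theta> t))"
    then have [measurable]: "A \<in> sets Q" by (simp add: sets')
    have [measurable]: "\<theta> t \<in> measurable P' P'" by measurable
    have "emeasure (distr P' P' (\<theta> t)) A = (\<integral>\<^sup>+\<omega>. indicator A \<omega> \<partial>distr P' P' (\<theta> t))"
      by (simp add: sets')
    also have "\<dots> = (\<integral>\<^sup>+\<omega>. indicator A (\<theta> t \<omega>) \<partial>P')"
      by (rule nn_integral_distr) (auto simp: sets' intro!: borel_measurable_indicator)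
    also have "\<dots> = (\<integral>\<^sup>+\<omega>. indicator saturation \<omega> * indicator A (\<theta> t \<omega>) \<partial>P)"
      by (rule nn_P') measurable
    also have "\<dots> = (\<integral>\<^sup>+\<omega>. indicator saturation (\<theta> t \<omega>) * indicator A (\<theta> t \<omega>) \<partial>P)"
      by (intro nn_integral_cong) (simp add: sp saturation_flow_iff indicator_def)
    also have "\<dots> = (\<integral>\<^sup>+\<omega>. indicator saturation \<omega> * indicator A \<omega> \<partial>P)"
      by (rule nn_integral_flow_palm[OF palm]) measurable
    also have "\<dots> = (\<integral>\<^sup>+\<omega>. indicator A \<omega> \<partial>P')"
      by (rule nn_P'[symmetric]) measurable
    finally show "emeasure (distr P' P' (\<theta> t)) A = emeasure P' A" by (simp add: sets')
  qed simp
  moreover have "is_palm_measure \<theta> P' regular_kernel Q"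
    unfolding is_palm_measure_def
  proof (intro conjI ballI)
    fix A assume "A \<in> sets P'"
    then have [measurable]: "A \<in> sets Q" by (simp add: sets')
    have "emeasure Q A = (\<integral>\<^sup>+\<omega>. \<integral>\<^sup>+s. indicator {0..1} s * indicator A (\<theta> s \<omega>) \<partial>\<xi> \<omega> \<partial>P)"
      by (rule emeasure_palm[OF palm]) measurable
    also have "\<dots> = (\<integral>\<^sup>+\<omega>. indicator saturation \<omega> *
        (\<integral>\<^sup>+s. indicator {0..1} s * indicator A (\<theta> s \<omega>) \<partial>regular_kernel \<omega>) \<partial>P)"
    proof (rule nn_integral_cong_AE)
      show "AE \<omega> in P. (\<integral>\<^sup>+s. indicator {0..1} s * indicator A (\<theta> s \<omega>) \<partial>\<xi> \<omega>) = indicator saturation \<omega> *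
        (\<integral>\<^sup>+s. indicator {0..1} s * indicator A (\<theta> s \<omega>) \<partial>regular_kernel \<omega>)"
        using AE_palm_saturation_or_null[OF palm] AE_space
      proof eventually_elim
        case (elim \<omega>)
        show ?case
        proof (cases "\<omega> \<in> saturation")
          case False
          then have null: "emeasure (\<xi> \<omega>) UNIV = 0" and "\<omega> \<in> space Q" using elim by (auto simp: sp)
          then have "AE s in \<xi> \<omega>. indicator {0..1} s * indicator A (\<theta> s \<omega>) = (0 :: ennreal)"
            by (intro AE_I[OF _ null]) (simp_all add: sets_kernel)
          then show ?thesis using False by (subst nn_integral_cong_AE[of _ "\<lambda>_. 0"]) auto
        qed (simp add: regular_kernel_def)
      qed
    qed
    also have "\<dots> = (\<integral>\<^sup>+\<omega>. \<integral>\<^sup>+s. indicator {0..1} s * indicator A (\<theta> s \<omega>) \<partial>regular_kernel \<omega> \<partial>P')"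
      by (rule nn_P'[symmetric]) measurable
    finally show "emeasure Q A = \<dots>" .
  qed (simp add: sets')
  ultimately interpret pair: palm_pair Q P' regular_kernel \<theta>
    by (intro palm_pair.intro regular.measured_flow_kernel_axioms palm_pair_axioms.intro)
  show ?thesis
    using shift_invariant_iff_regular[OF AE_saturation_if_palm[OF palm]] pair.mass_shift_invariant by blast
qed

lemma nn_integral_palm_gen_inverse:
  assumes palm: "palm_of_stationary \<theta> \<xi> Q P" and nz: "no_mass_on_zero \<xi> P"
    and "f \<in> borel_measurable Q" "w > 0"
  shows "(\<integral>\<^sup>+\<eta>. f \<eta> \<partial>P) = ennreal (inverse w) *
    (\<integral>\<^sup>+\<omega>. (\<integral>\<^sup>+s\<in>{0..gen_inverse \<xi> w \<omega>}. f (\<theta> s \<omega>) \<partial>lborel) \<partial>Q)"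
proof -
  interpret pair: palm_pair Q P regular_kernel \<theta>
    by (intro palm_pair_if_palm palm AE_palm_saturation nz)
  have "(\<integral>\<^sup>+\<omega>. (\<integral>\<^sup>+s\<in>{0..mass_inv (regular_kernel \<omega>) w}. f (\<theta> s \<omega>) \<partial>lborel) \<partial>Q) =
      (\<integral>\<^sup>+\<omega>. (\<integral>\<^sup>+s\<in>{0..gen_inverse \<xi> w \<omega>}. f (\<theta> s \<omega>) \<partial>lborel) \<partial>Q)"
    using AE_regular_kernel[OF AE_saturation_if_palm[OF palm]]
    by (intro nn_integral_cong_AE, eventually_elim) (simp add: gen_inverse_eq_mass_inv[of \<xi>])
  then show ?thesis using pair.nn_integral_stationary[of f w] assms by simp
qed

text \<open>\<open>regular.inversion\<close> is a stationary measure with Palm measure Q for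
  \<open>regular_kernel\<close>. The inversion formula shows that it does not charge the complement
  of \<open>saturation\<close>, since orbits starting in \<open>saturation\<close> stay there; so
  \<xi> may be put back.\<close>

lemma ex_palm_if_shift_invariant:
  assumes A: "\<And>r. shifted_law \<theta> Q (gen_inverse \<xi> r) = Q"
  shows "\<exists>P. palm_of_stationary \<theta> \<xi> Q P \<and> no_mass_on_zero \<xi> P"
proof (intro exI conjI)
  let ?P = "regular.inversion"
  have ae: "AE \<omega> in Q. \<omega> \<in> saturation" by (rule AE_saturation_if_shift_invariant[OF A])
  then have ex: regular.exchange
    using A shift_invariant_iff_regular by (intro regular.exchange_if_mass_shift_invariant) blast
  interpret pair: palm_pair Q ?P regular_kernel \<theta>
    by (intro palm_pair.intro regular.measured_flow_kernel_axioms palm_pair_axioms.intro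
        regular.sigma_finite_inversion regular.stationary_inversion regular.palm_inversion ex)
  have "(\<integral>\<^sup>+\<eta>. indicator (space Q - saturation) \<eta> \<partial>?P) = ennreal (inverse 1) *
      (\<integral>\<^sup>+\<omega>. (\<integral>\<^sup>+s\<in>{0..mass_inv (regular_kernel \<omega>) 1}. indicator (space Q - saturation) (\<theta> s \<omega>) \<partial>lborel) \<partial>Q)"
    by (rule pair.nn_integral_stationary) auto
  also have "(\<integral>\<^sup>+\<omega>. (\<integral>\<^sup>+s\<in>{0..mass_inv (regular_kernel \<omega>) 1}. indicator (space Q - saturation) (\<theta> s \<omega>) \<partial>lborel) \<partial>Q) =
      (\<integral>\<^sup>+\<omega>. 0 \<partial>Q)"
    using ae by (intro nn_integral_cong_AE, eventually_elim) (simp add: saturation_flow)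
  finally have null: "emeasure ?P (space Q - saturation) = 0" by simp
  have ae_P: "AE \<omega> in ?P. \<omega> \<in> saturation"
    using null by (intro AE_I[OF _ null]) auto
  have "random_measure ?P \<xi>"
    unfolding random_measure_def
  proof (intro conjI ballI)
    show "AE \<omega> in ?P. \<forall>C. compact C \<longrightarrow> emeasure (\<xi> \<omega>) C < \<infinity>"
      using ae_P
    proof (eventually_elim, intro allI impI)
      fix \<omega> and C :: "real set" assume \<omega>: "\<omega> \<in> saturation" and "compact C"
      interpret l: line_measure "\<xi> \<omega>" using \<omega> by (rule line_measure_if_saturation)
      obtain a where "C \<subseteq> cbox (- a) a"
        by (rule bounded_subset_cbox_symmetric[OF compact_imp_bounded[OF \<open>compact C\<close>]])
      then have "emeasure (\<xi> \<omega>) C \<le> emeasure (\<xi> \<omega>) {- a..a}" unfolding cbox_interval by (intro emeasure_mono) auto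
      then show "emeasure (\<xi> \<omega>) C < \<infinity>" using l.finite_Icc le_less_trans by blast
    qed
    show "(\<lambda>\<omega>. emeasure (\<xi> \<omega>) C) \<in> borel_measurable ?P" if "C \<in> sets borel" for C
      using kernel[OF that] measurable_cong_sets[OF pair.sets_P refl] by blast
  qed (simp add: sets_kernel)
  moreover have "invariant_rm \<theta> ?P \<xi>"
    unfolding invariant_rm_def using ae_P saturation_subset_good
    by (elim eventually_mono) (auto simp: good_def inv_set_def)
  moreover have "is_palm_measure \<theta> ?P \<xi> Q"
    using is_palm_measure_iff_regular[OF ae_P] pair.palm by simp
  ultimately show "palm_of_stationary \<theta> \<xi> Q ?P"
    using pair.P.sigma_finite_measure_axioms pair.stationary by (simp add: palm_of_stationary_def)
  have "{\<omega> \<in> space ?P. emeasure (\<xi> \<omega>) UNIV = 0} \<subseteq> space Q - saturation"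
    using line_measure.emeasure_UNIV[OF line_measure_if_saturation] by auto
  then have "emeasure ?P {\<omega> \<in> space ?P. emeasure (\<xi> \<omega>) UNIV = 0} \<le> emeasure ?P (space Q - saturation)"
    by (intro emeasure_mono) auto
  with null show "no_mass_on_zero \<xi> ?P" by (simp add: no_mass_on_zero_def)
qed

text \<open>The right-hand side of the inversion formula, taken here with w = 1, involves Q but not
  P.\<close>

lemma palm_unique:
  assumes P1: "palm_of_stationary \<theta> \<xi> Q P1" "no_mass_on_zero \<xi> P1"
    and P2: "palm_of_stationary \<theta> \<xi> Q P2" "no_mass_on_zero \<xi> P2"
  shows "P1 = P2"
proof (rule measure_eqI)
  show "sets P1 = sets P2" using sets_palm[OF P1(1)] sets_palm[OF P2(1)] by simp
  fix A assume A: "A \<in> sets P1"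
  then have [measurable]: "A \<in> sets Q" using sets_palm[OF P1(1)] by simp
  have "(\<integral>\<^sup>+\<eta>. indicator A \<eta> \<partial>P1) = (\<integral>\<^sup>+\<eta>. indicator A \<eta> \<partial>P2)"
    using nn_integral_palm_gen_inverse[OF P1, of "indicator A" 1] nn_integral_palm_gen_inverse[OF P2, of "indicator A" 1]
    by simp
  then show "emeasure P1 A = emeasure P2 A"
    using A sets_palm[OF P1(1)] sets_palm[OF P2(1)] by simp
qed

lemma shift_invariant_iff_mass_stationary:
  "(\<forall>r. shifted_law \<theta> Q (gen_inverse \<xi> r) = Q) \<longleftrightarrow> mass_stationary \<theta> Q \<xi>"
proof
  assume "\<forall>r. shifted_law \<theta> Q (gen_inverse \<xi> r) = Q"
  with AE_saturation_if_shift_invariant show "mass_stationary \<theta> Q \<xi>"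
    using shift_invariant_iff_regular mass_stationary_iff_regular
      regular.mass_stationary_if_mass_shift_invariant by blast
next
  assume "mass_stationary \<theta> Q \<xi>"
  with AE_saturation_if_mass_stationary show "\<forall>r. shifted_law \<theta> Q (gen_inverse \<xi> r) = Q"
    using shift_invariant_iff_regular mass_stationary_iff_regular
      regular.mass_shift_invariant_if_mass_stationary by blast
qed

end

text \<open>The second equivalence admits every stationary P, including those that charge paths
  without mass; the measure constructed in its proof does not, which links it to the uniqueness
  statement and the inversion formula.\<close>

theorem theorem3p1:
  fixes Q :: "'a measure"
    and \<theta> :: "real \<Rightarrow> 'a \<Rightarrow> 'a"
    and \<xi> :: "'a \<Rightarrow> real measure"
  assumes flow: "measurable_flow Q \<theta>"
    and sigma_finite: "sigma_finite_measure Q"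
    and rm: "random_measure Q \<xi>"
    and diffuse: "diffuse Q \<xi>"
    and invariant: "invariant_rm \<theta> Q \<xi>"
    and left_infinite: "emeasure Q {\<omega>\<in>space Q. emeasure (\<xi> \<omega>) {..<0} < \<infinity>} = 0"
    and right_infinite: "emeasure Q {\<omega>\<in>space Q. emeasure (\<xi> \<omega>) {0<..} < \<infinity>} = 0"
  shows "((\<forall>r. shifted_law \<theta> Q (gen_inverse \<xi> r) = Q) \<longleftrightarrow> mass_stationary \<theta> Q \<xi>) \<and>
    ((\<forall>r. shifted_law \<theta> Q (gen_inverse \<xi> r) = Q) \<longleftrightarrow>
       (\<exists>P. palm_of_stationary \<theta> \<xi> Q P)) \<and>
    ((\<exists>P. palm_of_stationary \<theta> \<xi> Q P) \<longrightarrow>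
       (\<exists>!P. palm_of_stationary \<theta> \<xi> Q P \<and> no_mass_on_zero \<xi> P)) \<and>
    (\<forall>P. palm_of_stationary \<theta> \<xi> Q P \<and> no_mass_on_zero \<xi> P \<longrightarrow>
       (\<forall>w>0. \<forall>f\<in>borel_measurable Q. (\<forall>\<omega>\<in>space Q. (0::real) \<le> f \<omega>) \<longrightarrow>
          (\<integral>\<^sup>+\<omega>. ennreal (f \<omega>) \<partial>P) =
            ennreal (inverse w) *
              (\<integral>\<^sup>+\<omega>. (\<integral>\<^sup>+s\<in>{0..gen_inverse \<xi> w \<omega>}. ennreal (f (\<theta> s \<omega>)) \<partial>lborel) \<partial>Q)))"
proof -
  interpret ae_flow_kernel Q \<xi> \<theta>
    by (intro ae_flow_kernel.intro flow_on.intro ae_flow_kernel_axioms.intro assms)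
  show ?thesis
  proof (intro conjI impI allI ballI)
    show "(\<forall>r. shifted_law \<theta> Q (gen_inverse \<xi> r) = Q) \<longleftrightarrow> mass_stationary \<theta> Q \<xi>"
      by (rule shift_invariant_iff_mass_stationary)
    show "(\<forall>r. shifted_law \<theta> Q (gen_inverse \<xi> r) = Q) \<longleftrightarrow> (\<exists>P. palm_of_stationary \<theta> \<xi> Q P)"
      using ex_palm_if_shift_invariant shift_invariant_if_palm by blast
    show "\<exists>!P. palm_of_stationary \<theta> \<xi> Q P \<and> no_mass_on_zero \<xi> P"
      if "\<exists>P. palm_of_stationary \<theta> \<xi> Q P"
      using that ex_palm_if_shift_invariant shift_invariant_if_palm palm_unique by blast
  next
    fix P :: "'a measure" and w :: real and f :: "'a \<Rightarrow> real"
    assume "palm_of_stationary \<theta> \<xi> Q P \<and> no_mass_on_zero \<xi> P" "0 < w" "f \<in> borel_measurable Q"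
    then show "(\<integral>\<^sup>+\<omega>. ennreal (f \<omega>) \<partial>P) = ennreal (inverse w) *
        (\<integral>\<^sup>+\<omega>. (\<integral>\<^sup>+s\<in>{0..gen_inverse \<xi> w \<omega>}. ennreal (f (\<theta> s \<omega>)) \<partial>lborel) \<partial>Q)"
      by (intro nn_integral_palm_gen_inverse[of P "\<lambda>\<omega>. ennreal (f \<omega>)"]) auto
  qed
qed

end
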